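(* Let $H$ be an infinite-dimensional complex Hilbert space, let $T\in B(H)$, and let $p(t) = (t-\lambda_1)^{k_1}\cdots (t-\lambda_n)^{k_n}$ be a polynomial, with $\lambda_1,\dots,\lambda_n\in\mathbb{C}$ pairwise distinct, such that $k_i\ge 2$ for $i=1,\ldots,n$. Suppose that $p(T)$ is compact. Then there is a compact operator $K$ on $H$ such that $p(T+K)=0$ and $\|T+K\|=\|T\|_e$.
   Context: $B(H)$ is the algebra of bounded operators on $H$ and $K(H)$ the ideal of compact operators. $\|T\|_e$ denotes the essential norm of $T$, i.e. the norm of the image of $T$ in the Calkin algebra $B(H)/K(H)$. *)

theory Defs
  imports "HOL-Analysis.Analysis" "HOL-Computational_Algebra.Polynomial"
begin

class complex_vector = real_vector +
  fixes scaleC :: "complex \<Rightarrow> 'a \<Rightarrow> 'a"  (infixr "*\<^sub>C" 75)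
  assumes scaleC_add_right: "a *\<^sub>C (x + y) = a *\<^sub>C x + a *\<^sub>C y"
    and scaleC_add_left: "(a + b) *\<^sub>C x = a *\<^sub>C x + b *\<^sub>C x"
    and scaleC_scaleC: "a *\<^sub>C (b *\<^sub>C x) = (a * b) *\<^sub>C x"
    and scaleC_one: "1 *\<^sub>C x = x"
    and scaleR_scaleC: "r *\<^sub>R x = complex_of_real r *\<^sub>C x"

global_interpretation complex_vector: vector_space "scaleC :: complex \<Rightarrow> 'a \<Rightarrow> 'a::complex_vector"
  by unfold_locales (simp_all add: scaleC_add_right scaleC_add_left scaleC_scaleC scaleC_one)

text \<open>The underlying real inner product is the real part of the complex one.  Hence positive
  definiteness of \<open>cinner\<close> and \<open>norm x = sqrt (Re (cinner x x))\<close> are inherited from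
  the class \<open>real_inner\<close>.  The inner product is linear in its first argument.\<close>

class complex_inner = complex_vector + real_inner +
  fixes cinner :: "'a \<Rightarrow> 'a \<Rightarrow> complex"
  assumes cinner_commute: "cinner x y = cnj (cinner y x)"
    and cinner_add_left: "cinner (x + y) z = cinner x z + cinner y z"
    and cinner_scaleC_left: "cinner (a *\<^sub>C x) y = a * cinner x y"
    and inner_eq_Re_cinner: "inner x y = Re (cinner x y)"

class chilbert_space = complex_inner + complete_space

definition infinite_dimensional :: "'a::complex_vector itself \<Rightarrow> bool" where
  "infinite_dimensional _ \<longleftrightarrow>
     \<not> (\<exists>B :: 'a set. finite B \<and> complex_vector.span B = UNIV)"

text \<open>Membership in $B(H)$ and in $K(H)$.  The library's \<open>bounded_linear\<close> only demands
  real linearity, so complex linearity is required separately.\<close>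

definition bounded_clinear :: "('a::chilbert_space \<Rightarrow> 'a) \<Rightarrow> bool" where
  "bounded_clinear T \<longleftrightarrow> Vector_Spaces.linear scaleC scaleC T \<and> bounded_linear T"

definition compact_operator :: "('a::chilbert_space \<Rightarrow> 'a) \<Rightarrow> bool" where
  "compact_operator K \<longleftrightarrow> bounded_clinear K \<and> compact (closure (K ` cball 0 1))"

text \<open>The element $T + K(H)$ of the Calkin algebra $B(H)/K(H)$, and its quotient norm.\<close>

definition calkin_coset :: "('a::chilbert_space \<Rightarrow> 'a) \<Rightarrow> ('a \<Rightarrow> 'a) set" where
  "calkin_coset T = {\<lambda>x. T x + K x |K. compact_operator K}"

definition essential_norm :: "('a::chilbert_space \<Rightarrow> 'a) \<Rightarrow> real" where
  "essential_norm T = (INF S\<in>calkin_coset T. onorm S)"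

definition poly_operator :: "complex poly \<Rightarrow> ('a::chilbert_space \<Rightarrow> 'a) \<Rightarrow> 'a \<Rightarrow> 'a" where
  "poly_operator p T = (\<lambda>x. \<Sum>i\<le>degree p. coeff p i *\<^sub>C (T ^^ i) x)"

end

theory Submission imports Defs begin

text \<open>Let \<open>c\<close> be the essential norm of \<open>T\<close> and \<open>\<mu> 0, \<dots>, \<mu> (m - 1)\<close> the roots of \<open>p\<close> with multiplicity.
  If a product \<open>X Y\<close> is compact, there is a projection \<open>P\<close> with \<open>X P\<close> and \<open>(1 - P) Y\<close> compact.
  Applied repeatedly to the factors of \<open>p(T)\<close>, this yields orthogonal projections
  \<open>P 0, \<dots>, P (m - 1)\<close> with sum \<open>1\<close> for which \<open>T\<close> is, modulo compact operators, block upper triangular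
  with diagonal blocks \<open>\<mu> j\<close>; the strictly triangular part can then be perturbed freely without
  affecting \<open>p = 0\<close>.  A block with \<open>\<bar>\<mu> j\<bar> > c\<close> is compact and
  is merged into another one, and a block with \<open>\<bar>\<mu> j\<bar> = c\<close> reduces \<open>T\<close> modulo
  compact operators.  On the remaining blocks \<open>\<bar>\<mu> j\<bar> < c\<close>, and the slack \<open>c\<^sup>2 - \<bar>\<mu> j\<bar>\<^sup>2\<close> allows one to
  bring the norm down to \<open>c\<close> by replacing the strictly triangular part \<open>N\<close> by \<open>J N J\<close>, where \<open>J\<close> is
  block diagonal and \<open>1 - J\<close> is compact.\<close>

text \<open>Two demands compete: a compact perturbation that lowers the norm to \<open>c\<close>
  generally destroys an algebraic relation, and one that restores the relation generally raises the
  norm. Triangular form reconciles them, because a triangular operator with the right scalar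
  diagonal blocks is annihilated whatever stands above the diagonal. The diagonal itself cannot be
  shrunk, so room has to come from slack in its entries. Where \<open>|\<mu> j| = c\<close> there is
  none, but a column of essential norm at most \<open>c\<close> whose diagonal entry already has
  modulus \<open>c\<close> has only compact entries elsewhere; the same estimate makes a block with
  a larger root compact. Only the upper bound for the norm needs an argument, as no compact
  perturbation has norm below \<open>c\<close>. The operator theory rests on square roots obtained
  by iteration and on projections onto kernels, which together replace the spectral theorem.\<close>

section \<open>Complex scalars over the real inner product\<close>

lemma inner_scaleC_swap: "inner (a *\<^sub>C x) y = inner x (cnj a *\<^sub>C y)"
  for x y :: "'a::complex_inner"
proof -
  have "cinner (a *\<^sub>C x) y = cnj (cinner (cnj a *\<^sub>C y) x)"
    by (metis cinner_commute cinner_scaleC_left complex_cnj_cnj complex_cnj_mult)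
  also have "\<dots> = cinner x (cnj a *\<^sub>C y)"
    by (metis cinner_commute)
  finally show ?thesis
    by (simp add: inner_eq_Re_cinner)
qed

lemma scaleC_of_real: "complex_of_real r *\<^sub>C x = r *\<^sub>R x"
  by (simp add: scaleR_scaleC)

lemma norm_scaleC: "norm (a *\<^sub>C x) = cmod a * norm x"
  for x :: "'a::complex_inner"
proof -
  have "(norm (a *\<^sub>C x))\<^sup>2 = inner x ((cnj a * a) *\<^sub>C x)"
    by (simp add: power2_norm_eq_inner inner_scaleC_swap scaleC_scaleC)
  also have "cnj a * a = complex_of_real ((cmod a)\<^sup>2)"
    by (metis complex_norm_square mult.commute)
  also have "inner x (complex_of_real ((cmod a)\<^sup>2) *\<^sub>C x) = (cmod a * norm x)\<^sup>2"
    by (simp add: scaleC_of_real power_mult_distrib power2_norm_eq_inner del: of_real_power)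
  finally show ?thesis
    by (simp add: power2_eq_iff_nonneg)
qed

lemma bounded_linear_scaleC_right: "bounded_linear (\<lambda>x :: 'a::complex_inner. a *\<^sub>C x)"
proof (rule bounded_linear_intro)
  fix x y :: 'a and r :: real
  show "a *\<^sub>C (x + y) = a *\<^sub>C x + a *\<^sub>C y" by (rule scaleC_add_right)
  show "a *\<^sub>C (r *\<^sub>R x) = r *\<^sub>R (a *\<^sub>C x)"
    by (simp add: scaleR_scaleC scaleC_scaleC mult.commute)
  show "norm (a *\<^sub>C x) \<le> norm x * cmod a"
    by (simp add: norm_scaleC mult.commute)
qed

lemma bounded_linear_scaleC_left: "bounded_linear (\<lambda>a. a *\<^sub>C x)"
  for x :: "'a::complex_inner"
proof (rule bounded_linear_intro)
  fix a b :: complex and r :: real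
  show "(a + b) *\<^sub>C x = a *\<^sub>C x + b *\<^sub>C x" by (rule scaleC_add_left)
  show "(r *\<^sub>R a) *\<^sub>C x = r *\<^sub>R (a *\<^sub>C x)"
    by (simp add: scaleR_scaleC scaleC_scaleC scaleR_conv_of_real)
  show "norm (a *\<^sub>C x) \<le> norm a * norm x"
    by (simp add: norm_scaleC)
qed

lemma bounded_clinear_iff:
  "bounded_clinear T \<longleftrightarrow> bounded_linear T \<and> (\<forall>a x. T (a *\<^sub>C x) = a *\<^sub>C T x)"
proof
  assume "bounded_clinear T"
  then show "bounded_linear T \<and> (\<forall>a x. T (a *\<^sub>C x) = a *\<^sub>C T x)"
    by (auto simp: bounded_clinear_def Vector_Spaces.linear_iff)
next
  assume *: "bounded_linear T \<and> (\<forall>a x. T (a *\<^sub>C x) = a *\<^sub>C T x)"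
  then have "T (x + y) = T x + T y" for x y
    by (simp add: bounded_linear.linear linear_add)
  with * show "bounded_clinear T"
    by (auto simp: bounded_clinear_def Vector_Spaces.linear_iff
        complex_vector.vector_space_axioms)
qed

instance chilbert_space \<subseteq> banach ..

section \<open>The algebra of bounded operators\<close>

text \<open>Bundling the bounded complex linear maps into a type makes ring normalisation, limits
  and summability available for operators.\<close>

typedef (overloaded) 'a op = "{T :: 'a::chilbert_space \<Rightarrow> 'a. bounded_clinear T}"
  morphisms app Op
proof
  show "(\<lambda>x. x) \<in> {T :: 'a \<Rightarrow> 'a. bounded_clinear T}"
    by (simp add: bounded_clinear_iff bounded_linear_ident)
qed

setup_lifting type_definition_op

lemma bounded_linear_app: "bounded_linear (app X)"
  using app[of X] by (simp add: bounded_clinear_iff)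

lemma app_scaleC: "app X (a *\<^sub>C x) = a *\<^sub>C app X x"
  using app[of X] by (simp add: bounded_clinear_iff)

lemma op_eqI: "(\<And>x. app X x = app Y x) \<Longrightarrow> X = Y"
  by (metis app_inject ext)

text \<open>The underlying space may be zero, and then \<open>0 = 1\<close>. Hence the unit comes
  from \<open>monoid_mult\<close>: \<open>ring_1\<close> and \<open>real_normed_algebra_1\<close>
  would demand \<open>0 \<noteq> 1\<close>.\<close>

instantiation op :: (chilbert_space) "{ring, monoid_mult, real_algebra}"
begin

lift_definition zero_op :: "'a op" is "\<lambda>x. 0"
  by (simp add: bounded_clinear_iff bounded_linear_zero)

lift_definition one_op :: "'a op" is "\<lambda>x. x"
  by (simp add: bounded_clinear_iff bounded_linear_ident)

lift_definition plus_op :: "'a op \<Rightarrow> 'a op \<Rightarrow> 'a op" is "\<lambda>S T x. S x + T x"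
  by (simp add: bounded_clinear_iff bounded_linear_add scaleC_add_right)

lift_definition uminus_op :: "'a op \<Rightarrow> 'a op" is "\<lambda>T x. - T x"
  by (simp add: bounded_clinear_iff bounded_linear_minus complex_vector.scale_minus_right)

lift_definition minus_op :: "'a op \<Rightarrow> 'a op \<Rightarrow> 'a op" is "\<lambda>S T x. S x - T x"
  by (simp add: bounded_clinear_iff bounded_linear_sub complex_vector.scale_right_diff_distrib)

lift_definition times_op :: "'a op \<Rightarrow> 'a op \<Rightarrow> 'a op" is "\<lambda>S T x. S (T x)"
  by (simp add: bounded_clinear_iff bounded_linear_compose)

lift_definition scaleR_op :: "real \<Rightarrow> 'a op \<Rightarrow> 'a op" is "\<lambda>r T x. r *\<^sub>R T x"
  by (auto simp add: bounded_clinear_iff scaleR_scaleC scaleC_scaleC mult.commute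
      intro: bounded_linear_compose[OF bounded_linear_scaleC_right])

instance
proof
  fix A B C :: "'a op" and r s :: real
  show "(A + B) + C = A + (B + C)" by transfer (simp add: add.assoc)
  show "A + B = B + A" by transfer (simp add: add.commute)
  show "0 + A = A" by transfer simp
  show "- A + A = 0" by transfer simp
  show "A - B = A + - B" by transfer simp
  show "A * B * C = A * (B * C)" by transfer simp
  show "(A + B) * C = A * C + B * C" by transfer simp
  show "A * (B + C) = A * B + A * C"
    by transfer (simp add: bounded_clinear_iff bounded_linear.linear linear_add)
  show "1 * A = A" by transfer simp
  show "A * 1 = A" by transfer simp
  show "r *\<^sub>R (A + B) = r *\<^sub>R A + r *\<^sub>R B" by transfer (simp add: scaleR_add_right)
  show "(r + s) *\<^sub>R A = r *\<^sub>R A + s *\<^sub>R A" by transfer (simp add: scaleR_add_left)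
  show "r *\<^sub>R s *\<^sub>R A = (r * s) *\<^sub>R A" by transfer simp
  show "1 *\<^sub>R A = A" by transfer simp
  show "r *\<^sub>R A * B = r *\<^sub>R (A * B)" by transfer simp
  show "A * r *\<^sub>R B = r *\<^sub>R (A * B)"
    by transfer (simp add: bounded_clinear_iff bounded_linear.linear linear_scale)
qed

end

lemma app_zero [simp]: "app 0 x = 0"
  and app_one [simp]: "app 1 x = x"
  and app_plus [simp]: "app (X + Y) x = app X x + app Y x"
  and app_uminus [simp]: "app (- X) x = - app X x"
  and app_minus [simp]: "app (X - Y) x = app X x - app Y x"
  and app_times [simp]: "app (X * Y) x = app X (app Y x)"
  and app_scaleR [simp]: "app (r *\<^sub>R X) x = r *\<^sub>R app X x"
  by (transfer, simp)+

lemma app_zero_right [simp]: "app X 0 = 0"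
  by (simp add: bounded_linear_app bounded_linear.linear linear_0)

lemma app_add: "app X (x + y) = app X x + app X y"
  and app_diff: "app X (x - y) = app X x - app X y"
  and app_scaleR_right: "app X (r *\<^sub>R x) = r *\<^sub>R app X x"
  and app_sum: "app X (sum f A) = (\<Sum>a\<in>A. app X (f a))"
  using bounded_linear_app[of X, THEN bounded_linear.linear]
  by (simp_all add: linear_add linear_diff linear_scale linear_sum)

lemma sum_app: "app (sum f A) x = (\<Sum>a\<in>A. app (f a) x)"
  by (induction A rule: infinite_finite_induct) auto

instantiation op :: (chilbert_space) real_normed_algebra
begin

definition norm_op :: "'a op \<Rightarrow> real" where "norm_op X = onorm (app X)"
definition dist_op :: "'a op \<Rightarrow> 'a op \<Rightarrow> real" where "dist_op X Y = norm (X - Y)"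
definition sgn_op :: "'a op \<Rightarrow> 'a op" where "sgn_op X = inverse (norm X) *\<^sub>R X"
definition uniformity_op :: "('a op \<times> 'a op) filter" where
  "uniformity_op = (INF e\<in>{0 <..}. principal {(x, y). dist x y < e})"
definition open_op :: "'a op set \<Rightarrow> bool" where
  "open_op U \<longleftrightarrow> (\<forall>x\<in>U. \<forall>\<^sub>F (x', y) in uniformity. x' = x \<longrightarrow> y \<in> U)"

instance
proof
  fix A B :: "'a op" and r :: real and U :: "'a op set"
  note bl = bounded_linear_app
  show "dist A B = norm (A - B)" by (rule dist_op_def)
  show "sgn A = inverse (norm A) *\<^sub>R A" by (rule sgn_op_def)
  show "uniformity = (INF e\<in>{0 <..}. principal {(x, y :: 'a op). dist x y < e})"
    by (rule uniformity_op_def)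
  show "open U \<longleftrightarrow> (\<forall>x\<in>U. \<forall>\<^sub>F (x', y) in uniformity. x' = x \<longrightarrow> y \<in> U)"
    by (rule open_op_def)
  show "norm A = 0 \<longleftrightarrow> A = 0"
    unfolding norm_op_def onorm_eq_0[OF bl] by (metis app_zero op_eqI)
  show "norm (A + B) \<le> norm A + norm B"
    unfolding norm_op_def using onorm_triangle[OF bl[of A] bl[of B]]
    by (simp add: plus_op.rep_eq)
  show "norm (r *\<^sub>R A) = \<bar>r\<bar> * norm A"
    unfolding norm_op_def scaleR_op.rep_eq by (rule onorm_scaleR[OF bl])
  show "norm (A * B) \<le> norm A * norm B"
    unfolding norm_op_def using onorm_compose[OF bl[of A] bl[of B]]
    by (simp add: times_op.rep_eq o_def)
qed

end

lemma norm_app: "norm (app X x) \<le> norm X * norm x"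
  unfolding norm_op_def by (rule onorm[OF bounded_linear_app])

lemma norm_op_le: "0 \<le> b \<Longrightarrow> (\<And>x. norm (app X x) \<le> b * norm x) \<Longrightarrow> norm X \<le> b"
  unfolding norm_op_def by (rule onorm_bound)

lemma continuous_on_app [continuous_intros]:
  "continuous_on S f \<Longrightarrow> continuous_on S (\<lambda>x. app X (f x))"
  using bounded_linear.continuous_on[OF bounded_linear_app] .

text \<open>Real bounded linear maps are complete, and complex linearity survives pointwise limits,
  so the limit stays in the type.\<close>

instance op :: (chilbert_space) banach
proof
  fix X :: "nat \<Rightarrow> 'a op"
  assume X: "Cauchy X"
  define b where "b Y = Blinfun (app Y)" for Y :: "'a op"
  have b [simp]: "blinfun_apply (b Y) x = app Y x" for Y x
    unfolding b_def by (simp add: bounded_linear_Blinfun_apply bounded_linear_app)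
  have norm_b: "norm (b Y) = norm Y" for Y
    by (simp add: norm_blinfun.rep_eq norm_op_def) (metis b ext)
  have diff_b: "b Y - b Z = b (Y - Z)" for Y Z
    by (rule blinfun_eqI) (simp add: blinfun.diff_left)
  have "Cauchy (\<lambda>n. b (X n))"
    using X unfolding Cauchy_def dist_norm diff_b norm_b .
  then obtain L where L: "(\<lambda>n. b (X n)) \<longlonglongrightarrow> L"
    using Cauchy_convergent[of "\<lambda>n. b (X n)"] by (auto simp: convergent_def)
  have lim: "(\<lambda>n. app (X n) x) \<longlonglongrightarrow> blinfun_apply L x" for x
    using blinfun.tendsto[OF L tendsto_const, of x] by simp
  have "blinfun_apply L (a *\<^sub>C x) = a *\<^sub>C blinfun_apply L x" for a x
  proof (rule LIMSEQ_unique)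
    show "(\<lambda>n. app (X n) (a *\<^sub>C x)) \<longlonglongrightarrow> blinfun_apply L (a *\<^sub>C x)" by (rule lim)
    show "(\<lambda>n. app (X n) (a *\<^sub>C x)) \<longlonglongrightarrow> a *\<^sub>C blinfun_apply L x"
      unfolding app_scaleC by (rule bounded_linear.tendsto[OF bounded_linear_scaleC_right lim])
  qed
  then have "bounded_clinear (blinfun_apply L)"
    by (simp add: bounded_clinear_iff blinfun.bounded_linear_right)
  then have "app (Op (blinfun_apply L)) = blinfun_apply L"
    by (simp add: Op_inverse)
  then have L_eq: "L = b (Op (blinfun_apply L))"
    by (intro blinfun_eqI) simp
  have "dist (b (X n)) L = dist (X n) (Op (blinfun_apply L))" for n
    by (subst L_eq) (simp only: dist_norm diff_b norm_b)
  then have "X \<longlonglongrightarrow> Op (blinfun_apply L)"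
    using L[THEN tendsto_dist_iff[THEN iffD1]] by (subst tendsto_dist_iff) simp
  then show "convergent X"
    by (rule convergentI)
qed

text \<open>The type is only a real algebra; complex scalars enter it as central elements.\<close>

lift_definition scal :: "complex \<Rightarrow> 'a::chilbert_space op" is "\<lambda>a x. a *\<^sub>C x"
  by (simp add: bounded_clinear_iff bounded_linear_scaleC_right scaleC_scaleC mult.commute)

lemma app_scal [simp]: "app (scal a) x = a *\<^sub>C x"
  by transfer simp

lemma scal_commute: "X * scal a = scal a * X"
  by (rule op_eqI) (simp add: app_scaleC)

section \<open>Adjoints and orthogonal projections\<close>

text \<open>The minimiser of \<open>(norm y)\<^sup>2 - 2 * f y\<close> on \<open>M\<close>
  represents \<open>f\<close>: a minimising sequence is Cauchy by the parallelogram law, and the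
  first variation at its limit vanishes. Taking the whole space for \<open>M\<close> yields
  adjoints, taking \<open>inner x\<close> for \<open>f\<close> yields projections.\<close>

lemma subspace_Riesz_representation:
  fixes M :: "'a::chilbert_space set" and f :: "'a \<Rightarrow> real"
  assumes M: "subspace M" "closed M" and f: "bounded_linear f"
  obtains m where "m \<in> M" "\<And>y. y \<in> M \<Longrightarrow> f y = inner m y"
proof -
  interpret f: bounded_linear f by (rule f)
  obtain B where B: "\<And>x. norm (f x) \<le> norm x * B"
    using f.bounded by blast
  define q where "q y = (norm y)\<^sup>2 - 2 * f y" for y
  have q_lower: "- B\<^sup>2 \<le> q y" for y
  proof -
    have "0 \<le> (norm y - B)\<^sup>2" by simp
    moreover have "f y \<le> norm y * B" using B[of y] by simp
    ultimately show ?thesis by (simp add: q_def power2_diff)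
  qed
  then have bdd: "bdd_below (q ` M)" by (auto intro!: bdd_belowI)
  have M0: "0 \<in> M" using M(1) by (rule subspace_0)
  define I where "I = (INF y\<in>M. q y)"
  have I: "I \<le> q y" if "y \<in> M" for y
    unfolding I_def by (rule cINF_lower[OF bdd that])
  have "\<exists>y\<in>M. q y < I + inverse (real (Suc n))" for n
    unfolding I_def by (rule cINF_less_iff[OF _ bdd, THEN iffD1]) (use M0 in \<open>auto simp: I_def\<close>)
  then obtain Y where Y: "\<And>n. Y n \<in> M" "\<And>n. q (Y n) < I + inverse (real (Suc n))"
    by metis
  have close: "(norm (x - y))\<^sup>2 \<le> 2 * (q x + q y - 2 * I)" if "x \<in> M" "y \<in> M" for x y
  proof -
    have "(1/2) *\<^sub>R (x + y) \<in> M"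
      using M(1) that by (intro subspace_scale subspace_add)
    then have "I \<le> q ((1/2) *\<^sub>R (x + y))" by (rule I)
    then show ?thesis
      unfolding q_def power2_norm_eq_inner
      by (simp add: f.add f.scaleR inner_add inner_diff inner_commute field_simps)
  qed
  have "Cauchy Y"
  proof (rule metric_CauchyI)
    fix e :: real assume "0 < e"
    then obtain N where N: "inverse (real (Suc N)) < e\<^sup>2 / 4"
      using reals_Archimedean[of "e\<^sup>2 / 4"] by auto
    have small: "inverse (real (Suc n)) < e\<^sup>2 / 4" if "n \<ge> N" for n
      using N that by (smt (verit) le_imp_inverse_le of_nat_0_less_iff of_nat_le_iff Suc_le_mono zero_less_Suc)
    have near: "q (Y n) < I + e\<^sup>2 / 4" if "n \<ge> N" for n
      using order.strict_trans[OF Y(2)[of n] add_strict_left_mono[OF small[OF that]]] .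
    have "dist (Y n) (Y k) < e" if "n \<ge> N" "k \<ge> N" for n k
    proof -
      have "(norm (Y n - Y k))\<^sup>2 < e\<^sup>2"
      proof -
        have "q (Y n) + q (Y k) < (I + e\<^sup>2 / 4) + (I + e\<^sup>2 / 4)"
          using near[OF that(1)] near[OF that(2)] by (rule add_strict_mono)
        then have "2 * (q (Y n) + q (Y k) - 2 * I) < e\<^sup>2" by (simp add: field_simps)
        then show ?thesis using close[OF Y(1) Y(1), of n k] by (rule le_less_trans[rotated])
      qed
      then show ?thesis
        using \<open>0 < e\<close> by (simp add: dist_norm power2_less_imp_less)
    qed
    then show "\<exists>N. \<forall>n\<ge>N. \<forall>k\<ge>N. dist (Y n) (Y k) < e" by blast
  qed
  then obtain m where m: "Y \<longlonglongrightarrow> m"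
    using Cauchy_convergent[of Y] by (auto simp: convergent_def)
  have mM: "m \<in> M"
    using closed_sequentially[OF M(2)] Y(1) m by blast
  have "(\<lambda>n. q (Y n)) \<longlonglongrightarrow> q m"
    unfolding q_def by (intro tendsto_intros f.tendsto m)
  moreover have "(\<lambda>n. I + inverse (real (Suc n))) \<longlonglongrightarrow> I + 0"
    by (intro tendsto_intros LIMSEQ_inverse_real_of_nat)
  ultimately have qm: "q m \<le> I"
    using Y(2) by (intro LIMSEQ_le[of "\<lambda>n. q (Y n)" "q m" "\<lambda>n. I + inverse (real (Suc n))" I])
      (auto intro: less_imp_le)
  show thesis
  proof (rule that[OF mM])
    fix y assume y: "y \<in> M"
    define b where "b = inner m y - f y"
    have quad: "0 \<le> t\<^sup>2 * (norm y)\<^sup>2 + 2 * t * b" for t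
    proof -
      have "m + t *\<^sub>R y \<in> M"
        using M(1) mM y by (intro subspace_scale subspace_add)
      then have "q m \<le> q (m + t *\<^sub>R y)"
        using I qm by fastforce
      then show ?thesis
        unfolding q_def b_def power2_norm_eq_inner
        by (simp add: f.add f.scaleR inner_add inner_commute power2_eq_square algebra_simps)
    qed
    have "b = 0"
    proof (cases "norm y = 0")
      case True
      then show ?thesis by (simp add: b_def)
    next
      case False
      \<comment> \<open>The quadratic in \<open>quad\<close> is minimal at this \<open>t\<close>,
        with value \<open>- b\<^sup>2 / (norm y)\<^sup>2\<close>; its nonnegativity forces
        \<open>b = 0\<close>.\<close>
      then have "(- b / (norm y)\<^sup>2)\<^sup>2 * (norm y)\<^sup>2 + 2 * (- b / (norm y)\<^sup>2) * b = - b\<^sup>2 / (norm y)\<^sup>2"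
        by (simp add: power2_eq_square)
      with quad[of "- b / (norm y)\<^sup>2"] have "b\<^sup>2 / (norm y)\<^sup>2 \<le> 0"
        by linarith
      with False have "b\<^sup>2 \<le> 0"
        by (simp add: divide_le_0_iff)
      then show ?thesis by simp
    qed
    then show "f y = inner m y" by (simp add: b_def)
  qed
qed

lemma inner_extensional:
  fixes x z :: "'a::real_inner"
  assumes "\<And>y. inner x y = inner z y"
  shows "x = z"
proof -
  have "inner (x - z) (x - z) = 0"
    unfolding inner_diff_left using assms by (rule right_minus_eq[THEN iffD2])
  then show ?thesis by simp
qed

text \<open>The adjoint is taken for the real inner product. It is still complex linear, since
  \<open>inner_scaleC_swap\<close> moves a complex scalar across, and so agrees with the complex
  adjoint.\<close>

lemma adjoint_exists: "\<exists>A'::'a::chilbert_space op. \<forall>x y. inner (app A' x) y = inner x (app A y)"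
proof -
  have "\<exists>z. \<forall>y. inner z y = inner x (app A y)" for x
  proof -
    have "bounded_linear (\<lambda>y. inner x (app A y))"
      by (rule bounded_linear_compose[OF bounded_linear_inner_right bounded_linear_app])
    from subspace_Riesz_representation[OF subspace_UNIV closed_UNIV this] show ?thesis
      by (metis UNIV_I)
  qed
  then obtain g where g: "\<And>x y. inner (g x) y = inner x (app A y)" by metis
  have "bounded_linear g"
  proof (rule bounded_linear_intro)
    fix x y and r :: real
    show "g (x + y) = g x + g y"
      by (rule inner_extensional) (simp add: g inner_add_left)
    show "g (r *\<^sub>R x) = r *\<^sub>R g x"
      by (rule inner_extensional) (simp add: g)
    show "norm (g x) \<le> norm x * norm A"
    proof (cases "norm (g x) = 0")
      case False
      have "norm (g x) * norm (g x) = inner x (app A (g x))"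
        by (metis g power2_norm_eq_inner power2_eq_square)
      also have "\<dots> \<le> norm x * norm (app A (g x))" by (rule norm_cauchy_schwarz)
      also have "\<dots> \<le> norm x * (norm A * norm (g x))"
        by (intro mult_left_mono norm_app) simp
      finally show ?thesis using False by (simp add: mult.assoc[symmetric])
    qed simp
  qed
  moreover have "g (a *\<^sub>C x) = a *\<^sub>C g x" for a x
    by (rule inner_extensional) (simp add: g inner_scaleC_swap app_scaleC)
  ultimately have "app (Op g) = g"
    by (simp add: Op_inverse bounded_clinear_iff)
  then show ?thesis using g by metis
qed

definition adj :: "'a::chilbert_space op \<Rightarrow> 'a op" where
  "adj A = (SOME A'. \<forall>x y. inner (app A' x) y = inner x (app A y))"

lemma inner_adj_left: "inner (app (adj A) x) y = inner x (app A y)"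
  using someI_ex[OF adjoint_exists[of A]] unfolding adj_def by blast

lemma inner_adj_right: "inner x (app (adj A) y) = inner (app A x) y"
  by (metis inner_adj_left inner_commute)

lemma adj_eqI: "(\<And>x y. inner (app B x) y = inner x (app A y)) \<Longrightarrow> adj A = B"
  by (rule op_eqI, rule inner_extensional) (simp add: inner_adj_left)

lemma adj_adj [simp]: "adj (adj A) = A"
  by (rule adj_eqI) (simp add: inner_adj_right)

lemma adj_zero [simp]: "adj 0 = 0"
  and adj_one [simp]: "adj 1 = 1"
  and adj_plus: "adj (A + B) = adj A + adj B"
  and adj_minus: "adj (A - B) = adj A - adj B"
  and adj_uminus: "adj (- A) = - adj A"
  and adj_times: "adj (A * B) = adj B * adj A"
  and adj_scaleR: "adj (r *\<^sub>R A) = r *\<^sub>R adj A"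
  and adj_scal: "adj (scal a) = scal (cnj a)"
  by (rule adj_eqI;
      simp add: inner_adj_left inner_add inner_diff inner_scaleC_swap)+

lemmas adj_simps = adj_plus adj_minus adj_uminus adj_times adj_scaleR adj_scal

lemma norm_adj_le: "norm (adj A) \<le> norm A"
proof (rule norm_op_le)
  fix x
  show "norm (app (adj A) x) \<le> norm A * norm x"
  proof (cases "norm (app (adj A) x) = 0")
    case False
    have "norm (app (adj A) x) * norm (app (adj A) x) = inner x (app A (app (adj A) x))"
      by (metis inner_adj_left power2_norm_eq_inner power2_eq_square)
    also have "\<dots> \<le> norm x * norm (app A (app (adj A) x))" by (rule norm_cauchy_schwarz)
    also have "\<dots> \<le> norm x * (norm A * norm (app (adj A) x))"
      by (intro mult_left_mono norm_app) simp
    finally show ?thesis using False by (simp add: mult.assoc[symmetric] mult.commute)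
  qed simp
qed simp

lemma continuous_on_adj: "continuous_on S (adj :: 'a::chilbert_space op \<Rightarrow> 'a op)"
proof (rule bounded_linear.continuous_on[OF _ continuous_on_id])
  show "bounded_linear (adj :: 'a op \<Rightarrow> 'a op)"
    by (rule bounded_linear_intro[where K=1]) (simp_all add: adj_plus adj_scaleR norm_adj_le)
qed

definition proj :: "'a::chilbert_space op \<Rightarrow> bool" where
  "proj P \<longleftrightarrow> adj P = P \<and> P * P = P"

lemma proj_adj: "proj P \<Longrightarrow> adj P = P"
  and proj_idem: "proj P \<Longrightarrow> P * P = P"
  by (simp_all add: proj_def)

lemma proj_idem_left: "proj P \<Longrightarrow> P * (P * X) = P * X"
  by (metis mult.assoc proj_idem)

lemma proj_one_minus: "proj P \<Longrightarrow> proj (1 - P)"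
  by (simp add: proj_def adj_simps algebra_simps)

lemma proj_app: "proj P \<Longrightarrow> app P (app P x) = app P x"
  by (metis app_times proj_idem)

lemma inner_proj: "proj P \<Longrightarrow> inner (app P x) y = inner x (app P y)"
  by (metis inner_adj_left proj_adj)

lemma proj_inner_self: "proj P \<Longrightarrow> inner (app P x) x = (norm (app P x))\<^sup>2"
  by (metis inner_proj power2_norm_eq_inner proj_app)

lemma proj_pythagoras:
  assumes "proj P"
  shows "(norm x)\<^sup>2 = (norm (app P x))\<^sup>2 + (norm (app (1 - P) x))\<^sup>2"
  using proj_inner_self[OF assms, of x] proj_inner_self[OF proj_one_minus[OF assms], of x]
  by (simp add: inner_diff_left power2_norm_eq_inner[of x])

lemma norm_proj_app_le:
  assumes "proj P"
  shows "norm (app P x) \<le> norm x"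
  by (rule power2_le_imp_le) (use proj_pythagoras[OF assms, of x] in auto)

lemma proj_exists:
  fixes M :: "'a::chilbert_space set"
  assumes M: "subspace M" "closed M" and cplx: "\<And>a x. x \<in> M \<Longrightarrow> a *\<^sub>C x \<in> M"
  obtains P where "proj P" "range (app P) = M"
proof -
  have "\<exists>z\<in>M. \<forall>y\<in>M. inner z y = inner x y" for x
    using subspace_Riesz_representation[OF M bounded_linear_inner_right[of x]] by metis
  then obtain g where g: "\<And>x. g x \<in> M" "\<And>x y. y \<in> M \<Longrightarrow> inner (g x) y = inner x y"
    by metis
  have uniq: "z = g x" if "z \<in> M" "\<And>y. y \<in> M \<Longrightarrow> inner z y = inner x y" for x z
  proof -
    have "z - g x \<in> M" using M(1) that(1) g(1) by (rule subspace_diff)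
    then have "inner (z - g x) (z - g x) = 0"
      using that(2) g(2) by (simp add: inner_diff_left)
    then show ?thesis by simp
  qed
  have "bounded_linear g"
  proof (rule bounded_linear_intro)
    fix x y and r :: real
    show "g (x + y) = g x + g y"
      by (rule sym, rule uniq) (use M(1) g in \<open>auto simp: inner_add_left intro: subspace_add\<close>)
    show "g (r *\<^sub>R x) = r *\<^sub>R g x"
      by (rule sym, rule uniq) (use M(1) g in \<open>auto intro: subspace_scale\<close>)
    show "norm (g x) \<le> norm x * 1"
    proof (cases "norm (g x) = 0")
      case False
      have "norm (g x) * norm (g x) = inner x (g x)"
        using g(2)[OF g(1), of x x] by (metis power2_norm_eq_inner power2_eq_square)
      also have "\<dots> \<le> norm x * norm (g x)" by (rule norm_cauchy_schwarz)
      finally show ?thesis using False by simp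
    qed simp
  qed
  moreover have "g (a *\<^sub>C x) = a *\<^sub>C g x" for a x
    by (rule sym, rule uniq) (use cplx g in \<open>auto simp: inner_scaleC_swap\<close>)
  ultimately have app_g: "app (Op g) = g"
    by (simp add: Op_inverse bounded_clinear_iff)
  have fix_M: "g x = x" if "x \<in> M" for x
    using uniq[of x x] that by simp
  show thesis
  proof (rule that)
    have "adj (Op g) = Op g"
    proof (rule adj_eqI)
      show "inner (app (Op g) x) y = inner x (app (Op g) y)" for x y
        unfolding app_g by (metis g inner_commute)
    qed
    moreover have "Op g * Op g = Op g"
      by (rule op_eqI) (simp add: app_g fix_M g(1))
    ultimately show "proj (Op g)" by (simp add: proj_def)
    show "range (app (Op g)) = M"
      unfolding app_g using g(1) fix_M by (metis image_subset_iff rangeI subsetI subset_antisym)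
  qed
qed

text \<open>That the range of \<open>P\<close> is the whole kernel is phrased with operators
  \<open>B\<close> instead of vectors, which keeps later arguments purely algebraic.\<close>

lemma proj_kernel:
  obtains P where "proj P" "A * P = 0" "\<And>B. A * B = 0 \<Longrightarrow> P * B = B"
proof -
  define M where "M = {x. app A x = 0}"
  have "subspace M"
    by (rule subspaceI) (auto simp: M_def app_add app_scaleR_right)
  moreover have "closed M"
    unfolding M_def by (intro closed_Collect_eq continuous_intros)
  ultimately obtain P where P: "proj P" "range (app P) = M"
    using proj_exists[of M] by (auto simp: M_def app_scaleC)
  show thesis
  proof (rule that[OF P(1)])
    show "A * P = 0"
      using P(2) by (intro op_eqI) (auto simp: M_def)
    show "P * B = B" if "A * B = 0" for B
    proof (rule op_eqI)
      fix x
      have "app B x \<in> range (app P)"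
        unfolding P(2) M_def using that by (simp flip: app_times)
      then show "app (P * B) x = app B x"
        using proj_app[OF P(1)] by auto
    qed
  qed
qed

section \<open>Positive operators\<close>

text \<open>Self-adjointness has to be demanded: \<open>inner\<close> is only the real part of the
  complex form, and \<open>scal \<i>\<close> satisfies
  \<open>inner (app (scal \<i>) x) x = 0\<close>.\<close>

definition pos :: "'a::chilbert_space op \<Rightarrow> bool" where
  "pos A \<longleftrightarrow> adj A = A \<and> (\<forall>x. 0 \<le> inner (app A x) x)"

lemma pos_adj: "pos A \<Longrightarrow> adj A = A"
  and pos_inner: "pos A \<Longrightarrow> 0 \<le> inner (app A x) x"
  by (simp_all add: pos_def)

lemma pos_adj_times: "pos (adj A * A)"
  by (simp add: pos_def adj_simps inner_adj_left)

lemma pos_square: "adj A = A \<Longrightarrow> pos (A * A)"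
  using pos_adj_times[of A] by simp

lemma pos_plus: "pos A \<Longrightarrow> pos B \<Longrightarrow> pos (A + B)"
  by (simp add: pos_def adj_simps inner_add_left)

lemma pos_scaleR: "pos A \<Longrightarrow> 0 \<le> r \<Longrightarrow> pos (r *\<^sub>R A)"
  by (simp add: pos_def adj_simps)

lemma pos_zero: "pos 0"
  by (simp add: pos_def)

lemma pos_sum: "(\<And>i. i \<in> I \<Longrightarrow> pos (A i)) \<Longrightarrow> pos (sum A I)"
  by (induction I rule: infinite_finite_induct) (auto intro: pos_zero pos_plus)

lemma pos_conj: "pos A \<Longrightarrow> pos (adj B * A * B)"
  by (simp add: pos_def adj_simps inner_adj_left mult.assoc)

lemma inner_app_le: "inner (app A x) x \<le> norm A * (norm x)\<^sup>2"
proof -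
  have "inner (app A x) x \<le> norm (app A x) * norm x" by (rule norm_cauchy_schwarz)
  also have "\<dots> \<le> norm A * norm x * norm x" by (intro mult_right_mono norm_app) simp
  finally show ?thesis by (simp add: power2_eq_square mult.assoc)
qed

lemma pos_scaleR_one_minus: "adj A = A \<Longrightarrow> norm A \<le> r \<Longrightarrow> pos (r *\<^sub>R 1 - A)"
  by (auto simp: pos_def adj_simps inner_diff_left power2_norm_eq_inner[symmetric]
      intro!: order_trans[OF inner_app_le mult_right_mono])

text \<open>Nonnegativity of the form at \<open>x - s *\<^sub>R app A x\<close> with
  \<open>s = 1 / norm A\<close>; in operator terms \<open>A\<^sup>2 \<le> norm A * A\<close>. It
  turns bounds on a quadratic form into bounds on vectors.\<close>

lemma norm_square_pos_le:
  assumes "pos A"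
  shows "(norm (app A x))\<^sup>2 \<le> norm A * inner (app A x) x"
proof (cases "norm A = 0")
  case True
  then show ?thesis by simp
next
  case False
  define s y where "s = inverse (norm A)" and "y = app A x"
  have s: "s > 0" using False by (simp add: s_def)
  have sym: "inner (app A y) x = inner y y"
    unfolding y_def by (metis assms inner_adj_left pos_adj)
  have "0 \<le> inner (app A (x - s *\<^sub>R y)) (x - s *\<^sub>R y)"
    using assms by (rule pos_inner)
  also have "\<dots> = inner y x - 2 * s * inner y y + s\<^sup>2 * inner (app A y) y"
    by (simp add: app_diff app_scaleR_right inner_diff_left inner_diff_right sym
        y_def[symmetric] power2_eq_square algebra_simps)
  also have "\<dots> \<le> inner y x - 2 * s * inner y y + s\<^sup>2 * (norm A * (norm y)\<^sup>2)"
    by (intro add_left_mono mult_left_mono inner_app_le) simp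
  also have "\<dots> = inner y x - s * (norm y)\<^sup>2"
    using False by (simp add: s_def dot_square_norm power2_eq_square)
  finally have "s * (norm y)\<^sup>2 \<le> inner y x" by simp
  then have "norm A * (s * (norm y)\<^sup>2) \<le> norm A * inner y x"
    by (intro mult_left_mono) auto
  moreover have "norm A * (s * (norm y)\<^sup>2) = (norm y)\<^sup>2"
    using False by (simp add: s_def)
  ultimately show ?thesis
    by (simp only: y_def)
qed

text \<open>By \<open>norm_square_pos_le\<close>, \<open>(norm A)\<^sup>2 \<le> norm A * r\<close>,
  from which one factor \<open>norm A\<close> cancels.\<close>

lemma norm_pos_le:
  assumes A: "pos A" and le: "pos (r *\<^sub>R 1 - A)" and r: "0 \<le> r"
  shows "norm A \<le> r"
proof -
  have "norm A \<le> sqrt (norm A * r)"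
  proof (rule norm_op_le)
    fix x
    have "(norm (app A x))\<^sup>2 \<le> norm A * inner (app A x) x"
      using A by (rule norm_square_pos_le)
    also have "\<dots> \<le> norm A * (r * (norm x)\<^sup>2)"
      using pos_inner[OF le, of x]
      by (intro mult_left_mono) (simp_all add: inner_diff_left power2_norm_eq_inner)
    also have "\<dots> = (sqrt (norm A * r) * norm x)\<^sup>2"
      using r by (simp add: power_mult_distrib)
    finally show "norm (app A x) \<le> sqrt (norm A * r) * norm x"
      by (rule power2_le_imp_le) (simp add: r)
  qed (simp add: r)
  then have "(norm A)\<^sup>2 \<le> norm A * r"
    using r by (metis norm_ge_zero power_mono real_sqrt_pow2 mult_nonneg_nonneg)
  then show ?thesis
    using r by (cases "norm A = 0") (auto simp: power2_eq_square)
qed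

section \<open>Square roots, absolute values and inverses\<close>

text \<open>A substitute for functional calculus: the square root lies in every such set that
  contains the operator. Choosing commutants, exact or modulo compact operators, turns this into
  commutation relations.\<close>

definition closed_subalgebra :: "'a::{real_normed_algebra,monoid_mult} set \<Rightarrow> bool" where
  "closed_subalgebra S \<longleftrightarrow> 1 \<in> S \<and> (\<forall>x\<in>S. \<forall>y\<in>S. x + y \<in> S) \<and> (\<forall>x\<in>S. \<forall>y\<in>S. x * y \<in> S) \<and>
     (\<forall>r. \<forall>x\<in>S. r *\<^sub>R x \<in> S) \<and> closed S"

lemma closed_subalgebraD:
  assumes "closed_subalgebra S"
  shows "1 \<in> S" "x \<in> S \<Longrightarrow> y \<in> S \<Longrightarrow> x + y \<in> S" "x \<in> S \<Longrightarrow> y \<in> S \<Longrightarrow> x * y \<in> S"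
    "x \<in> S \<Longrightarrow> r *\<^sub>R x \<in> S" "x \<in> S \<Longrightarrow> y \<in> S \<Longrightarrow> x - y \<in> S" "closed S"
proof -
  show *: "1 \<in> S" "x \<in> S \<Longrightarrow> y \<in> S \<Longrightarrow> x + y \<in> S" "x \<in> S \<Longrightarrow> y \<in> S \<Longrightarrow> x * y \<in> S"
    "x \<in> S \<Longrightarrow> r *\<^sub>R x \<in> S" "closed S"
    using assms unfolding closed_subalgebra_def by auto
  show "x - y \<in> S" if "x \<in> S" "y \<in> S"
  proof -
    have "x + (- 1) *\<^sub>R y \<in> S"
      using assms that unfolding closed_subalgebra_def by blast
    then show ?thesis by simp
  qed
qed

lemma closed_subalgebra_commutant:
  "closed_subalgebra {U :: 'a::{real_normed_algebra,monoid_mult}. U * V = V * U}"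
  unfolding closed_subalgebra_def
proof (intro conjI ballI allI)
  show "closed {U. U * V = V * U}"
    by (intro closed_Collect_eq continuous_intros)
qed (auto simp: algebra_simps, metis mult.assoc)

text \<open>The classical iteration for \<open>1 - sqrt (1 - x)\<close>.  At the scalar \<open>x = 1\<close> it increases to
  \<open>1\<close>, and it dominates the iteration at every element \<open>x\<close> of norm at most \<open>1\<close>.\<close>

fun sqrt_iter :: "'a::real_normed_algebra \<Rightarrow> nat \<Rightarrow> 'a" where
  "sqrt_iter x 0 = 0"
| "sqrt_iter x (Suc n) = (1/2) *\<^sub>R (x + sqrt_iter x n * sqrt_iter x n)"

lemma sqrt_iter_commute:
  assumes "u * x = x * u"
  shows "u * sqrt_iter x n = sqrt_iter x n * u"
proof (induction n)
  case (Suc n)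
  have "u * (sqrt_iter x n * sqrt_iter x n) = sqrt_iter x n * sqrt_iter x n * u"
    by (metis Suc mult.assoc)
  then show ?case
    using assms by (simp add: algebra_simps)
qed simp

lemma norm_sqrt_iter_le:
  assumes "norm x \<le> 1"
  shows "norm (sqrt_iter x n) \<le> sqrt_iter (1::real) n"
proof (induction n)
  case (Suc n)
  have "norm (x + sqrt_iter x n * sqrt_iter x n) \<le> norm x + norm (sqrt_iter x n) * norm (sqrt_iter x n)"
    by (meson norm_triangle_mono norm_mult_ineq order_refl)
  also have "\<dots> \<le> 1 + sqrt_iter 1 n * sqrt_iter 1 n"
    using assms Suc by (intro add_mono mult_mono) (auto intro: order_trans[OF norm_ge_zero])
  finally show ?case by simp
qed simp

text \<open>The iterates commute, so the difference of two squares factors into sum times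
  difference, and both factors are dominated by their values at the scalar \<open>1\<close>.\<close>

lemma norm_sqrt_iter_diff_le:
  assumes x: "norm x \<le> 1"
  shows "norm (sqrt_iter x (Suc n) - sqrt_iter x n) \<le> sqrt_iter (1::real) (Suc n) - sqrt_iter 1 n"
proof (induction n)
  case 0
  then show ?case using x by simp
next
  case (Suc n)
  let ?Y = "sqrt_iter x" and ?y = "sqrt_iter (1::real)"
  have *: "?Y (Suc n) * ?Y n = ?Y n * ?Y (Suc n)"
    by (rule sqrt_iter_commute) (rule sqrt_iter_commute[OF refl, symmetric])
  have "?Y (Suc (Suc n)) - ?Y (Suc n)
      = (1/2) *\<^sub>R (?Y (Suc n) * ?Y (Suc n) - ?Y n * ?Y n)"
    by (simp only: sqrt_iter.simps(2)[of x "Suc n"] sqrt_iter.simps(2)[of x n, symmetric]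
        scaleR_diff_right[symmetric])
      (simp add: algebra_simps)
  also have "\<dots> = (1/2) *\<^sub>R ((?Y (Suc n) + ?Y n) * (?Y (Suc n) - ?Y n))"
    by (simp only: algebra_simps *)
  finally have "norm (?Y (Suc (Suc n)) - ?Y (Suc n))
      = 1/2 * norm ((?Y (Suc n) + ?Y n) * (?Y (Suc n) - ?Y n))"
    by (simp only: norm_scaleR)
  also have "\<dots> \<le> 1/2 * ((?y (Suc n) + ?y n) * (?y (Suc n) - ?y n))"
  proof (rule mult_left_mono)
    have "norm ((?Y (Suc n) + ?Y n) * (?Y (Suc n) - ?Y n))
        \<le> norm (?Y (Suc n) + ?Y n) * norm (?Y (Suc n) - ?Y n)"
      by (rule norm_mult_ineq)
    also have "\<dots> \<le> (?y (Suc n) + ?y n) * (?y (Suc n) - ?y n)"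
    proof (rule mult_mono[OF _ Suc])
      show *: "norm (?Y (Suc n) + ?Y n) \<le> ?y (Suc n) + ?y n"
        using norm_sqrt_iter_le[OF x] by (intro norm_triangle_mono)
      show "0 \<le> ?y (Suc n) + ?y n"
        using * norm_ge_zero order_trans by blast
    qed simp
    finally show "norm ((?Y (Suc n) + ?Y n) * (?Y (Suc n) - ?Y n))
        \<le> (?y (Suc n) + ?y n) * (?y (Suc n) - ?y n)" .
  qed simp
  also have "\<dots> = ?y (Suc (Suc n)) - ?y (Suc n)"
    by (simp only: sqrt_iter.simps(2)[of 1 "Suc n"] sqrt_iter.simps(2)[of "1::real" n])
      (simp add: field_simps)
  finally show ?case .
qed

lemma sqrt_iter_real_le_one: "sqrt_iter (1::real) n \<le> 1"
proof (induction n)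
  case (Suc n)
  have "0 \<le> sqrt_iter (1::real) n"
    using norm_sqrt_iter_le[of "1::real" n] by (simp add: order_trans[OF abs_ge_zero])
  then have "sqrt_iter (1::real) n * sqrt_iter 1 n \<le> 1 * 1"
    using Suc by (intro mult_mono) auto
  then show ?case by simp
qed simp

text \<open>At the scalar \<open>1\<close> the iteration is increasing and bounded, so its
  increments are summable; they majorise the increments at \<open>x\<close>.\<close>

lemma sqrt_iter_convergent:
  fixes x :: "'a::{real_normed_algebra,banach}"
  assumes x: "norm x \<le> 1"
  shows "convergent (sqrt_iter x)"
proof -
  let ?Y = "sqrt_iter x" and ?y = "sqrt_iter (1::real)"
  have incr: "?y n \<le> ?y (Suc n)" for n
    using norm_sqrt_iter_diff_le[of "1::real" n] norm_ge_zero[of "?y (Suc n) - ?y n"] by auto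
  have "convergent ?y"
    by (rule Bseq_monoseq_convergent[OF _ monoI1])
      (use incr sqrt_iter_real_le_one norm_sqrt_iter_le[of "1::real"] in
        \<open>auto intro!: BseqI'[of _ 1] intro: lift_Suc_mono_le
          simp del: sqrt_iter.simps simp: order_trans[OF norm_sqrt_iter_le]\<close>)
  then have "summable (\<lambda>n. ?y (Suc n) - ?y n)"
    by (rule telescope_summable[OF convergent_LIMSEQ_iff[THEN iffD1]])
  then have "summable (\<lambda>n. ?Y (Suc n) - ?Y n)"
    by (rule summable_comparison_test'[where N=0]) (rule norm_sqrt_iter_diff_le[OF x])
  then have "convergent (\<lambda>n. \<Sum>i<n. ?Y (Suc i) - ?Y i)"
    by (simp add: summable_iff_convergent)
  moreover have "(\<Sum>i<n. ?Y (Suc i) - ?Y i) = ?Y n" for n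
    by (simp only: sum_lessThan_telescope) simp
  ultimately show ?thesis by simp
qed

lemma pos_sqrt_exists:
  fixes X :: "'a::chilbert_space op"
  assumes X: "pos X"
  obtains Z where "pos Z" "Z * Z = X" "\<And>S. closed_subalgebra S \<Longrightarrow> X \<in> S \<Longrightarrow> Z \<in> S"
proof -
  \<comment> \<open>The added \<open>1\<close> keeps \<open>c\<close> positive even for
    \<open>X = 0\<close>.\<close>
  define c where "c = norm X + 1"
  have c: "c > 0" by (simp add: c_def add_nonneg_pos)
  define W where "W = 1 - inverse c *\<^sub>R X"
  have adjW: "adj W = W" by (simp add: W_def adj_simps pos_adj[OF X])
  have W1: "norm W \<le> 1"
  proof (rule norm_pos_le)
    have "pos (inverse c *\<^sub>R (c *\<^sub>R 1 - X))"
      using c by (intro pos_scaleR pos_scaleR_one_minus pos_adj[OF X]) (auto simp: c_def)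
    then show "pos W"
      using c by (simp add: W_def algebra_simps)
    show "pos (1 *\<^sub>R 1 - W)"
      using c pos_scaleR[OF X, of "inverse c"] by (simp add: W_def)
  qed simp
  obtain L where L: "sqrt_iter W \<longlonglongrightarrow> L"
    using sqrt_iter_convergent[OF W1] by (auto simp: convergent_def)
  have "(\<lambda>n. sqrt_iter W (Suc n)) \<longlonglongrightarrow> (1/2) *\<^sub>R (W + L * L)"
    unfolding sqrt_iter.simps by (intro tendsto_intros L)
  moreover have "(\<lambda>n. sqrt_iter W (Suc n)) \<longlonglongrightarrow> L"
    using L by (rule LIMSEQ_Suc)
  ultimately have "L = (1/2) *\<^sub>R (W + L * L)"
    using LIMSEQ_unique by blast
  then have "2 *\<^sub>R L = 2 *\<^sub>R ((1/2) *\<^sub>R (W + L * L))" by (rule arg_cong)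
  \<comment> \<open>Equivalently \<open>(1 - L)\<^sup>2 = 1 - W = X / c\<close>, so that
    \<open>sqrt c * (1 - L)\<close> is a root of \<open>X\<close>.\<close>
  then have LL: "L + L = W + L * L"
    by (simp add: scaleR_2)
  have adj_iter: "adj (sqrt_iter W n) = sqrt_iter W n" for n
    by (induction n) (simp_all add: adj_simps adjW)
  have "(\<lambda>n. adj (sqrt_iter W n)) \<longlonglongrightarrow> adj L"
    using continuous_on_adj[of UNIV] L
    by (metis continuous_on_def UNIV_I at_within_open_NO_MATCH open_UNIV tendsto_compose_at isCont_tendsto_compose continuous_on_eq_continuous_at)
  then have adjL: "adj L = L"
    unfolding adj_iter using L LIMSEQ_unique by blast
  have "norm L \<le> 1"
    by (rule LIMSEQ_le_const2[OF tendsto_norm[OF L]])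
      (use norm_sqrt_iter_le[OF W1] sqrt_iter_real_le_one order_trans in blast)
  then have pos: "pos (1 - L)"
    using pos_scaleR_one_minus[OF adjL, of 1] by simp
  define Z where "Z = sqrt c *\<^sub>R (1 - L)"
  show thesis
  proof (rule that)
    show "pos Z" unfolding Z_def using c by (intro pos_scaleR pos) simp
    have "(1 - L) * (1 - L) = 1 - W"
      using LL by (simp add: algebra_simps)
    then show "Z * Z = X"
      using c by (simp add: Z_def W_def mult.assoc[symmetric])
    fix S :: "'a op set" assume S: "closed_subalgebra S" and XS: "X \<in> S"
    note S' = closed_subalgebraD[OF S]
    have WS: "W \<in> S" unfolding W_def by (intro S' XS)
    have "sqrt_iter W n \<in> S" for n
    proof (induction n)
      case 0
      have "0 *\<^sub>R 1 \<in> S" by (intro S')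
      then show ?case by simp
    qed (auto simp del: scaleR_half_double intro!: S' WS)
    then have "L \<in> S" using closed_sequentially[OF S'(6)] L by blast
    then show "Z \<in> S" unfolding Z_def by (intro S')
  qed
qed

text \<open>\<open>Z\<close> is the absolute value of \<open>C\<close>, and \<open>Q\<close> projects onto a spectral subspace on which
  \<open>C \<le> 0\<close>, with \<open>C \<ge> 0\<close> on the orthogonal complement.\<close>

lemma sign_decomposition:
  fixes C :: "'a::chilbert_space op"
  assumes C: "adj C = C"
  obtains Z Q where "pos Z" "proj Q" "Z * Q = Q * Z" "C * Q = - (Z * Q)" "C * (1 - Q) = Z * (1 - Q)"
    "Z * Z = C * C" "\<And>S. closed_subalgebra S \<Longrightarrow> C * C \<in> S \<Longrightarrow> Z \<in> S"
    "\<And>B. C * B = 0 \<Longrightarrow> Q * B = B"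
proof -
  obtain Z where Z: "pos Z" "Z * Z = C * C"
      "\<And>S. closed_subalgebra S \<Longrightarrow> C * C \<in> S \<Longrightarrow> Z \<in> S"
    using pos_sqrt_exists[OF pos_square[OF C]] by metis
  have ZC: "Z * C = C * Z"
    using Z(3)[OF closed_subalgebra_commutant[of C]] by (simp add: mult.assoc)
  \<comment> \<open>\<open>Q\<close> projects onto the kernel of \<open>Z + C\<close>, where
    \<open>C = - Z\<close>. By \<open>(Z + C) * (Z - C) = 0\<close> this kernel contains the range
    of \<open>Z - C\<close>.\<close>
  obtain Q where Q: "proj Q" "(Z + C) * Q = 0" "\<And>B. (Z + C) * B = 0 \<Longrightarrow> Q * B = B"
    using proj_kernel[of "Z + C"] by metis
  have "(Z + C) * (Z - C) = 0"
    using Z(2) ZC by (simp add: algebra_simps)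
  then have QD: "Q * (Z - C) = Z - C" by (rule Q(3))
  then have "adj (Q * (Z - C)) = adj (Z - C)" by simp
  then have DQ: "(Z - C) * Q = Z - C"
    by (simp add: adj_simps C pos_adj[OF Z(1)] proj_adj[OF Q(1)])
  have "adj ((Z + C) * Q) = 0" using Q(2) by simp
  then have QS: "Q * (Z + C) = 0"
    by (simp add: adj_simps C pos_adj[OF Z(1)] proj_adj[OF Q(1)])
  have CQ: "C * Q = - (Z * Q)"
    using Q(2) by (simp add: algebra_simps eq_neg_iff_add_eq_0)
  have QC: "Q * C = - (Q * Z)"
    using QS by (simp add: algebra_simps eq_neg_iff_add_eq_0)
  \<comment> \<open>Both \<open>Z * Q\<close> and \<open>Q * Z\<close> turn out to be half of
    \<open>Z - C\<close>, the negative part of \<open>C\<close>; hence they agree.\<close>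
  have 1: "Z * Q + Z * Q = Z - C" using DQ CQ by (simp add: algebra_simps)
  have 2: "Q * Z + Q * Z = Z - C" using QD QC by (simp add: algebra_simps)
  have "2 *\<^sub>R (Z * Q) = 2 *\<^sub>R (Q * Z)" unfolding scaleR_2 using 1 2 by simp
  then have "Z * Q = Q * Z" by simp
  moreover have "C * (1 - Q) = Z * (1 - Q)"
    using 1 CQ by (simp add: algebra_simps)
  \<comment> \<open>As \<open>Z\<^sup>2 = C\<^sup>2\<close>, \<open>Z\<close> vanishes wherever
    \<open>C\<close> does, so \<open>B\<close> maps into the kernel of \<open>Z + C\<close>.\<close>
  moreover have "Q * B = B" if "C * B = 0" for B
  proof -
    have "pos (adj B * (Z * Z) * B)" by (simp add: pos_conj pos_square pos_adj[OF Z(1)])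
    have "adj (Z * B) * (Z * B) = adj B * (Z * Z) * B"
      by (simp add: adj_simps pos_adj[OF Z(1)] mult.assoc)
    also have "\<dots> = 0" using that by (simp add: Z(2) mult.assoc)
    finally have *: "app (adj (Z * B) * (Z * B)) x = 0" for x by simp
    have "Z * B = 0"
    proof (rule op_eqI)
      fix x
      have "inner (app (Z * B) x) (app (Z * B) x) = inner (app (adj (Z * B) * (Z * B)) x) x"
        by (simp only: app_times[of "adj (Z * B)"] inner_adj_left)
      then show "app (Z * B) x = app 0 x"
        unfolding * by (simp only: inner_zero_left inner_eq_zero_iff app_zero)
    qed
    then show ?thesis using that by (intro Q(3)) (simp add: algebra_simps)
  qed
  ultimately show thesis using that[of Z Q] Z Q(1) CQ by blast
qed

text \<open>Neumann series: \<open>1 + H = (1 + h) (1 - Y)\<close> with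
  \<open>0 \<le> Y \<le> h / (1 + h)\<close>, hence \<open>norm Y < 1\<close>.\<close>

lemma pos_one_plus_inverse:
  fixes H :: "'a::chilbert_space op"
  assumes H: "pos H"
  obtains J where "J * (1 + H) = 1" "(1 + H) * J = 1"
proof -
  define h where "h = norm H"
  have h: "0 \<le> h" by (simp add: h_def)
  define Y where "Y = 1 - inverse (1 + h) *\<^sub>R (1 + H)"
  have Y_alt: "Y = inverse (1 + h) *\<^sub>R (h *\<^sub>R 1 - H)"
  proof -
    have "h *\<^sub>R 1 - H = (1 + h) *\<^sub>R 1 - (1 + H)" by (simp add: scaleR_add_left)
    then show ?thesis
      using h by (simp only: Y_def scaleR_diff_right scaleR_scaleR) simp
  qed
  have "norm Y \<le> h / (1 + h)"
  proof (rule norm_pos_le)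
    show "pos Y"
      unfolding Y_alt using h by (intro pos_scaleR pos_scaleR_one_minus pos_adj[OF H]) (auto simp: h_def)
    have "(h / (1 + h)) *\<^sub>R 1 - Y = inverse (1 + h) *\<^sub>R H"
      by (simp add: Y_alt scaleR_diff_right divide_inverse mult.commute)
    then show "pos ((h / (1 + h)) *\<^sub>R 1 - Y)"
      using h by (simp add: pos_scaleR H)
  qed (use h in simp)
  also have "\<dots> < 1" using h by simp
  finally have Y1: "norm Y < 1" .
  \<comment> \<open>The estimate starts at the first power, since \<open>norm 1\<close> need not be
    \<open>1\<close>.\<close>
  have pow: "norm (Y ^ Suc n) \<le> norm Y ^ Suc n" for n
  proof (induction n)
    case (Suc n)
    have "norm (Y * Y ^ Suc n) \<le> norm Y * norm (Y ^ Suc n)" by (rule norm_mult_ineq)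
    also have "\<dots> \<le> norm Y * norm Y ^ Suc n" by (intro mult_left_mono Suc) simp
    finally show ?case by simp
  qed simp
  have "summable (\<lambda>n. norm Y ^ Suc n)"
    using Y1 by (subst summable_Suc_iff) (simp add: summable_geometric)
  then have "summable (\<lambda>n. Y ^ Suc n)"
    by (rule summable_comparison_test'[where N=0]) (rule pow)
  then have summ: "summable (\<lambda>n. Y ^ n)" by (simp only: summable_Suc_iff)
  define J where "J = (\<Sum>n. Y ^ n)"
  have J: "(\<lambda>n. Y ^ n) sums J" unfolding J_def using summ by (rule summable_sums)
  have tel: "(\<lambda>n. Y ^ n - Y ^ Suc n) sums (Y ^ 0 - 0)"
    using summable_LIMSEQ_zero[OF summ] by (rule telescope_sums')
  have "(\<lambda>n. Y ^ n * (1 - Y)) sums (J * (1 - Y))"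
    using J by (rule bounded_linear.sums[OF bounded_linear_mult_left])
  moreover have "Y ^ n * (1 - Y) = Y ^ n - Y ^ Suc n" for n
    by (simp add: algebra_simps power_commutes)
  ultimately have JY: "J * (1 - Y) = 1"
    using sums_unique2[OF tel] by simp
  have "(\<lambda>n. (1 - Y) * Y ^ n) sums ((1 - Y) * J)"
    using J by (rule bounded_linear.sums[OF bounded_linear_mult_right])
  moreover have "(1 - Y) * Y ^ n = Y ^ n - Y ^ Suc n" for n
    by (simp add: algebra_simps)
  ultimately have YJ: "(1 - Y) * J = 1"
    using sums_unique2[OF tel] by simp
  have 1: "1 - Y = inverse (1 + h) *\<^sub>R (1 + H)" by (simp add: Y_def)
  show thesis
    by (rule that[of "inverse (1 + h) *\<^sub>R J"]) (use JY YJ in \<open>simp_all add: 1\<close>)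
qed

section \<open>Compact operators\<close>

definition cpt :: "'a::chilbert_space op \<Rightarrow> bool" where
  "cpt X \<longleftrightarrow> compact_operator (app X)"

lemma cpt_iff: "cpt X \<longleftrightarrow> compact (closure (app X ` cball 0 1))"
  using app[of X] by (simp add: cpt_def compact_operator_def)

lemma cptI:
  assumes "compact C" "app X ` cball 0 1 \<subseteq> C"
  shows "cpt X"
proof -
  have "closure (app X ` cball 0 1) \<subseteq> C"
    using assms by (simp add: closure_minimal compact_imp_closed)
  then show ?thesis
    using compact_Int_closed[OF assms(1) closed_closure] by (metis cpt_iff inf.absorb2)
qed

lemma cpt_finite_cover:
  fixes X :: "'a::chilbert_space op"
  assumes "cpt X" "0 < e"
  obtains F where "finite F" "\<And>x. norm x \<le> 1 \<Longrightarrow> \<exists>a\<in>F. dist a (app X x) < e"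
proof -
  obtain F where F: "finite F" "closure (app X ` cball 0 1) \<subseteq> (\<Union>a\<in>F. ball a e)"
    using assms by (auto simp: cpt_iff compact_eq_totally_bounded)
  show thesis
  proof (rule that[OF F(1)])
    fix x :: 'a assume "norm x \<le> 1"
    then have "app X x \<in> closure (app X ` cball 0 1)"
      by (intro subsetD[OF closure_subset] imageI) simp
    then have "app X x \<in> (\<Union>a\<in>F. ball a e)" using F(2) by (rule subsetD[rotated])
    then show "\<exists>a\<in>F. dist a (app X x) < e" by simp
  qed
qed

lemma cptI_finite_cover:
  fixes X :: "'a::chilbert_space op"
  assumes "\<And>e. 0 < e \<Longrightarrow> \<exists>F. finite F \<and> (\<forall>x. norm x \<le> 1 \<longrightarrow> (\<exists>a\<in>F. dist a (app X x) \<le> e))"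
  shows "cpt X"
  unfolding cpt_iff compact_eq_totally_bounded
proof (intro conjI allI impI)
  show "complete (closure (app X ` cball 0 1))"
    by (simp add: complete_eq_closed)
  fix e :: real assume "0 < e"
  then obtain F where F: "finite F" "\<And>x. norm x \<le> 1 \<Longrightarrow> \<exists>a\<in>F. dist a (app X x) \<le> e / 2"
    using assms[of "e / 2"] by auto
  have "app X ` cball 0 1 \<subseteq> (\<Union>a\<in>F. cball a (e / 2))"
    using F(2) by auto
  moreover have "closed (\<Union>a\<in>F. cball a (e / 2))"
    using F(1) by (intro closed_UN) auto
  ultimately have "closure (app X ` cball 0 1) \<subseteq> (\<Union>a\<in>F. cball a (e / 2))"
    by (rule closure_minimal)
  also have "\<dots> \<subseteq> (\<Union>a\<in>F. ball a e)"
    using \<open>0 < e\<close> by fastforce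
  finally show "\<exists>F. finite F \<and> closure (app X ` cball 0 1) \<subseteq> (\<Union>a\<in>F. ball a e)"
    using F(1) by blast
qed

lemma cpt_zero: "cpt 0"
  by (rule cptI[of "{0}"]) auto

text \<open>One point is picked for every pair of small balls that \<open>L\<close> and
  \<open>M\<close> hit simultaneously; the images of these points under \<open>X\<close> form a
  finite net. Points compared are at distance at most \<open>2\<close>, so the errors add up to
  \<open>e / 6 * 2 + 4 * (e / 6) = e\<close>.\<close>

lemma cptI_dominated:
  fixes X :: "'a::chilbert_space op"
  assumes "\<And>e. 0 < e \<Longrightarrow> \<exists>L M. cpt L \<and> cpt M \<and>
    (\<forall>x. norm (app X x) \<le> e * norm x + norm (app L x) + norm (app M x))"
  shows "cpt X"
proof (rule cptI_finite_cover)
  fix e :: real assume e: "0 < e"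
  then obtain L M where LM: "cpt L" "cpt M"
    and dom: "\<And>x. norm (app X x) \<le> e / 6 * norm x + norm (app L x) + norm (app M x)"
    using assms[of "e / 6"] by auto
  have e6: "0 < e / 6" using e by simp
  obtain F where F: "finite F" "\<And>x. norm x \<le> 1 \<Longrightarrow> \<exists>a\<in>F. dist a (app L x) < e / 6"
    using cpt_finite_cover[OF LM(1) e6] by metis
  obtain G where G: "finite G" "\<And>x. norm x \<le> 1 \<Longrightarrow> \<exists>a\<in>G. dist a (app M x) < e / 6"
    using cpt_finite_cover[OF LM(2) e6] by metis
  define near where "near a b x \<longleftrightarrow> norm x \<le> 1 \<and> dist a (app L x) < e / 6 \<and> dist b (app M x) < e / 6"
    for a b x
  define rep where "rep a b = (SOME x. near a b x)" for a b
  have rep: "near a b (rep a b)" if "near a b x" for a b x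
    unfolding rep_def using that by (rule someI)
  show "\<exists>F. finite F \<and> (\<forall>x. norm x \<le> 1 \<longrightarrow> (\<exists>a\<in>F. dist a (app X x) \<le> e))"
  proof (intro exI conjI allI impI)
    show "finite ((\<lambda>(a, b). app X (rep a b)) ` (F \<times> G))"
      using F(1) G(1) by simp
    fix x :: 'a assume x: "norm x \<le> 1"
    then obtain a b where ab: "a \<in> F" "b \<in> G" "near a b x"
      using F(2) G(2) unfolding near_def by metis
    let ?y = "rep a b"
    have y: "near a b ?y" using ab(3) by (rule rep)
    have 1: "norm (app L (?y - x)) \<le> e / 6 + e / 6"
      using dist_triangle3[of "app L ?y" "app L x" a] ab(3) y
      by (simp add: near_def app_diff dist_norm)
    have 2: "norm (app M (?y - x)) \<le> e / 6 + e / 6"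
      using dist_triangle3[of "app M ?y" "app M x" b] ab(3) y
      by (simp add: near_def app_diff dist_norm)
    have "norm (?y - x) \<le> 2"
      using x y norm_triangle_ineq4[of ?y x] by (simp add: near_def)
    then have "e / 6 * norm (?y - x) \<le> e / 6 * 2"
      using e by (intro mult_left_mono) auto
    with dom[of "?y - x"] 1 2 have "norm (app X (?y - x)) \<le> e" by linarith
    then have "dist (app X ?y) (app X x) \<le> e" by (simp add: dist_norm app_diff)
    with ab show "\<exists>a\<in>(\<lambda>(a, b). app X (rep a b)) ` (F \<times> G). dist a (app X x) \<le> e"
      by force
  qed
qed

lemma cpt_mult_left:
  assumes "cpt X"
  shows "cpt (A * X)"
proof (rule cptI)
  show "compact (app A ` closure (app X ` cball 0 1))"
    using assms unfolding cpt_iff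
    by (intro compact_continuous_image continuous_on_app continuous_on_id)
  show "app (A * X) ` cball 0 1 \<subseteq> app A ` closure (app X ` cball 0 1)"
    using closure_subset[of "app X ` cball 0 1"] by auto
qed

lemma cpt_scaleR: "cpt X \<Longrightarrow> cpt (r *\<^sub>R X)"
  using cpt_mult_left[of X "r *\<^sub>R 1"] by simp

lemma cpt_mult_right:
  fixes X B :: "'a::chilbert_space op"
  assumes "cpt X"
  shows "cpt (X * B)"
proof (rule cptI)
  let ?C = "closure (app X ` cball 0 1)" and ?b = "norm B + 1"
  show "compact ((\<lambda>x. ?b *\<^sub>R x) ` ?C)"
    using assms unfolding cpt_iff by (rule compact_scaling)
  show "app (X * B) ` cball 0 1 \<subseteq> (\<lambda>x. ?b *\<^sub>R x) ` ?C"
  proof (rule image_subsetI)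
    fix x :: 'a assume "x \<in> cball 0 1"
    then have x: "norm x \<le> 1" by simp
    have b: "?b > 0" by (simp add: add_nonneg_pos)
    have "norm (app B x) \<le> norm B * norm x" by (rule norm_app)
    also have "\<dots> \<le> ?b * 1" using x by (intro mult_mono) auto
    finally have "norm (inverse ?b *\<^sub>R app B x) \<le> 1"
      using b by (simp add: field_simps)
    then have "app X (inverse ?b *\<^sub>R app B x) \<in> ?C"
      by (intro subsetD[OF closure_subset] imageI) simp
    moreover have "app (X * B) x = ?b *\<^sub>R app X (inverse ?b *\<^sub>R app B x)"
      using b by (simp add: app_scaleR_right)
    ultimately show "app (X * B) x \<in> (\<lambda>x. ?b *\<^sub>R x) ` ?C" by blast
  qed
qed

lemma cpt_plus:
  fixes X Y :: "'a::chilbert_space op"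
  assumes "cpt X" "cpt Y"
  shows "cpt (X + Y)"
proof (rule cptI_dominated, intro exI conjI allI)
  fix e :: real and x :: 'a
  show "cpt X" "cpt Y" by fact+
  assume "0 < e"
  then have "0 \<le> e * norm x" by simp
  then show "norm (app (X + Y) x) \<le> e * norm x + norm (app X x) + norm (app Y x)"
    using norm_triangle_ineq[of "app X x" "app Y x"] by simp
qed

lemma cpt_minus: "cpt X \<Longrightarrow> cpt Y \<Longrightarrow> cpt (X - Y)"
  using cpt_plus[of X "(- 1) *\<^sub>R Y"] cpt_scaleR[of Y "- 1"] by simp

lemma cpt_uminus: "cpt X \<Longrightarrow> cpt (- X)"
  using cpt_scaleR[of X "- 1"] by simp

lemma cpt_minus_commute: "cpt (X - Y) \<Longrightarrow> cpt (Y - X)"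
  using cpt_uminus[of "X - Y"] by simp

lemma cpt_sum: "(\<And>i. i \<in> I \<Longrightarrow> cpt (X i)) \<Longrightarrow> cpt (sum X I)"
  by (induction I rule: infinite_finite_induct) (auto intro: cpt_zero cpt_plus)

text \<open>Completing the square: with \<open>s\<close> the sum of the two error norms,
  \<open>(e * norm x + s / e)\<^sup>2\<close> is at least
  \<open>e\<^sup>2 * (norm x)\<^sup>2 + norm x * s\<close>, which leads back to
  \<open>cptI_dominated\<close>.\<close>

lemma cpt_square_dominated:
  fixes X :: "'a::chilbert_space op"
  assumes "\<And>e. 0 < e \<Longrightarrow> \<exists>L M. cpt L \<and> cpt M \<and>
    (\<forall>x. (norm (app X x))\<^sup>2 \<le> e * (norm x)\<^sup>2 + norm x * (norm (app L x) + norm (app M x)))"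
  shows "cpt X"
proof (rule cptI_dominated)
  fix e :: real assume e: "0 < e"
  then obtain L M where LM: "cpt L" "cpt M" and dom: "\<And>x. (norm (app X x))\<^sup>2 \<le>
      e\<^sup>2 * (norm x)\<^sup>2 + norm x * (norm (app L x) + norm (app M x))"
    using assms[of "e\<^sup>2"] by auto
  show "\<exists>L M. cpt L \<and> cpt M \<and>
    (\<forall>x. norm (app X x) \<le> e * norm x + norm (app L x) + norm (app M x))"
  proof (intro exI conjI allI)
    show "cpt (inverse e *\<^sub>R L)" "cpt (inverse e *\<^sub>R M)" by (intro cpt_scaleR LM)+
    fix x
    define s where "s = norm (app L x) + norm (app M x)"
    have s: "0 \<le> s" by (simp add: s_def)
    have "(e * norm x + inverse e * s)\<^sup>2
        = e\<^sup>2 * (norm x)\<^sup>2 + 2 * (norm x * s) + (inverse e * s)\<^sup>2"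
      using e by (simp add: power2_eq_square field_simps)
    moreover have "0 \<le> norm x * s" "0 \<le> (inverse e * s)\<^sup>2" using s by auto
    ultimately have "(norm (app X x))\<^sup>2 \<le> (e * norm x + inverse e * s)\<^sup>2"
      using dom[of x] unfolding s_def[symmetric] by linarith
    then have "norm (app X x) \<le> e * norm x + inverse e * s"
      by (rule power2_le_imp_le) (use e s in simp)
    then show "norm (app X x) \<le> e * norm x + norm (app (inverse e *\<^sub>R L) x)
        + norm (app (inverse e *\<^sub>R M) x)"
      using e by (simp add: s_def distrib_left)
  qed
qed

lemma cpt_square_le:
  fixes X L :: "'a::chilbert_space op"
  assumes "cpt L" "\<And>x. (norm (app X x))\<^sup>2 \<le> norm x * norm (app L x)"
  shows "cpt X"
proof (rule cpt_square_dominated, intro exI conjI allI)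
  show "cpt L" "cpt 0" by (fact, rule cpt_zero)
  fix e :: real and x :: 'a assume "0 < e"
  then have "0 \<le> e * (norm x)\<^sup>2" by simp
  then show "(norm (app X x))\<^sup>2 \<le> e * (norm x)\<^sup>2 + norm x * (norm (app L x) + norm (app 0 x))"
    using assms(2)[of x] by simp
qed

lemma cpt_adj_timesD:
  fixes X :: "'a::chilbert_space op"
  assumes "cpt (adj X * X)"
  shows "cpt X"
proof (rule cpt_square_le[OF assms])
  fix x
  have "(norm (app X x))\<^sup>2 = inner x (app (adj X * X) x)"
    by (simp add: inner_adj_right power2_norm_eq_inner)
  also have "\<dots> \<le> norm x * norm (app (adj X * X) x)"
    by (rule norm_cauchy_schwarz)
  finally show "(norm (app X x))\<^sup>2 \<le> norm x * norm (app (adj X * X) x)" .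
qed

lemma cpt_squareD: "adj X = X \<Longrightarrow> cpt (X * X) \<Longrightarrow> cpt X"
  using cpt_adj_timesD[of X] by simp

text \<open>Schauder's theorem, from \<open>cpt_adj_timesD\<close> at \<open>adj X\<close>: the
  product \<open>adj (adj X) * adj X = X * adj X\<close> is compact.\<close>

lemma cpt_adj:
  assumes "cpt X"
  shows "cpt (adj X)"
  by (rule cpt_adj_timesD) (simp add: cpt_mult_right assms)

text \<open>Here \<open>U\<^sup>2 \<le> norm U * U \<le> norm U * (U + V)\<close>, so the form of a
  compact operator dominates \<open>(norm (app U x))\<^sup>2\<close>.\<close>

lemma cpt_pos_plusD:
  fixes U V :: "'a::chilbert_space op"
  assumes "pos U" "pos V" "cpt (U + V)"
  shows "cpt U"
proof (rule cpt_square_le)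
  show "cpt (norm U *\<^sub>R (U + V))" by (intro cpt_scaleR assms)
  fix x
  have "(norm (app U x))\<^sup>2 \<le> norm U * inner (app U x) x"
    using assms(1) by (rule norm_square_pos_le)
  also have "\<dots> \<le> norm U * inner (app (U + V) x) x"
    using pos_inner[OF assms(2), of x] by (intro mult_left_mono) (simp_all add: inner_add_left)
  also have "\<dots> \<le> norm U * (norm (app (U + V) x) * norm x)"
    by (intro mult_left_mono norm_cauchy_schwarz) simp
  finally show "(norm (app U x))\<^sup>2 \<le> norm x * norm (app (norm U *\<^sub>R (U + V)) x)"
    by (simp add: mult_ac)
qed

lemma closed_cpt: "closed {X. cpt X}"
  unfolding closed_sequential_limits
proof (intro allI impI, elim conjE)
  fix X :: "nat \<Rightarrow> 'a op" and L
  assume X: "\<forall>n. X n \<in> {X. cpt X}" and lim: "X \<longlonglongrightarrow> L"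
  have "cpt L"
  proof (rule cptI_dominated)
    fix e :: real assume "0 < e"
    then obtain n where n: "norm (X n - L) < e"
      using lim unfolding LIMSEQ_iff by blast
    show "\<exists>K M. cpt K \<and> cpt M \<and>
      (\<forall>x. norm (app L x) \<le> e * norm x + norm (app K x) + norm (app M x))"
    proof (intro exI conjI allI)
      show "cpt (X n)" "cpt 0" using X cpt_zero by auto
      fix x
      have "norm (app (X n - L) x) \<le> e * norm x"
        using norm_app[of "X n - L" x] n by (meson less_imp_le mult_right_mono norm_ge_zero order_trans)
      then show "norm (app L x) \<le> e * norm x + norm (app (X n) x) + norm (app 0 x)"
        using norm_triangle_ineq4[of "app (X n) x" "app (X n) x - app L x"] by simp
    qed
  qed
  then show "L \<in> {X. cpt X}" by simp
qed

section \<open>Congruence modulo the compact operators\<close>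

definition calkin_eq :: "'a::chilbert_space op \<Rightarrow> 'a op \<Rightarrow> bool"  (infix "\<approx>\<^sub>K" 50) where
  "X \<approx>\<^sub>K Y \<longleftrightarrow> cpt (X - Y)"

lemma calkin_refl [simp]: "X \<approx>\<^sub>K X"
  by (simp add: calkin_eq_def cpt_zero)

lemma calkin_sym: "X \<approx>\<^sub>K Y \<Longrightarrow> Y \<approx>\<^sub>K X"
  unfolding calkin_eq_def by (rule cpt_minus_commute)

lemma calkin_trans [trans]: "X \<approx>\<^sub>K Y \<Longrightarrow> Y \<approx>\<^sub>K Z \<Longrightarrow> X \<approx>\<^sub>K Z"
  unfolding calkin_eq_def using cpt_plus[of "X - Y" "Y - Z"] by simp

lemma calkin_plus: "X \<approx>\<^sub>K X' \<Longrightarrow> Y \<approx>\<^sub>K Y' \<Longrightarrow> X + Y \<approx>\<^sub>K X' + Y'"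
  unfolding calkin_eq_def using cpt_plus[of "X - X'" "Y - Y'"] by (simp add: algebra_simps)

lemma calkin_times:
  assumes "X \<approx>\<^sub>K X'" "Y \<approx>\<^sub>K Y'"
  shows "X * Y \<approx>\<^sub>K X' * Y'"
proof -
  have "X * Y - X' * Y' = (X - X') * Y + X' * (Y - Y')" by (simp add: algebra_simps)
  then show ?thesis
    using assms unfolding calkin_eq_def by (simp add: cpt_plus cpt_mult_left cpt_mult_right)
qed

lemma calkin_sum: "(\<And>i. i \<in> I \<Longrightarrow> X i \<approx>\<^sub>K Y i) \<Longrightarrow> sum X I \<approx>\<^sub>K sum Y I"
  unfolding calkin_eq_def by (simp flip: sum_subtractf) (rule cpt_sum)

lemma calkin_zero: "X \<approx>\<^sub>K 0 \<longleftrightarrow> cpt X"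
  by (simp add: calkin_eq_def)

lemma cpt_cong: "X \<approx>\<^sub>K Y \<Longrightarrow> cpt X \<longleftrightarrow> cpt Y"
  by (metis calkin_sym calkin_trans calkin_zero)

text \<open>The preimage of a commutant in the Calkin algebra, closed because the compact operators
  are. With \<open>pos_sqrt_exists\<close>, a square root commutes modulo compact operators with
  whatever its square does.\<close>

lemma closed_subalgebra_calkin_commutant:
  "closed_subalgebra {U :: 'a::chilbert_space op. U * V \<approx>\<^sub>K V * U}"
  unfolding closed_subalgebra_def
proof (intro conjI ballI allI; (unfold mem_Collect_eq)?)
  fix U W :: "'a op" and r :: real
  assume U: "U * V \<approx>\<^sub>K V * U"
  show "r *\<^sub>R U * V \<approx>\<^sub>K V * r *\<^sub>R U"
    using cpt_scaleR[of "U * V - V * U" r] U by (simp add: calkin_eq_def scaleR_diff_right)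
  assume W: "W * V \<approx>\<^sub>K V * W"
  show "(U + W) * V \<approx>\<^sub>K V * (U + W)"
    using calkin_plus[OF U W] by (simp add: algebra_simps)
  have "U * (W * V) \<approx>\<^sub>K U * (V * W)" by (intro calkin_times W) simp
  moreover have "U * V * W \<approx>\<^sub>K V * U * W" by (intro calkin_times U) simp
  ultimately show "U * W * V \<approx>\<^sub>K V * (U * W)"
    using calkin_trans by (simp add: mult.assoc)
next
  have "closed ((\<lambda>U. U * V - V * U) -` {X. cpt X})"
    by (intro closed_vimage closed_cpt continuous_intros)
  then show "closed {U. U * V \<approx>\<^sub>K V * U}"
    by (simp add: vimage_def calkin_eq_def)
qed simp

section \<open>Finite-dimensional subspaces and the non-compact identity\<close>

lemma subspace_complex_span: "subspace (complex_vector.span B)"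
  by (rule subspaceI)
    (auto simp: scaleR_scaleC intro: complex_vector.span_zero complex_vector.span_add complex_vector.span_scale)

text \<open>With \<open>P\<close> the projection onto the old span, the span enlarged by
  \<open>a\<close> is the preimage under \<open>1 - P\<close> of the complex line through
  \<open>app (1 - P) a\<close>; that line is zero or a rescaled isometric copy of
  \<open>complex\<close>.\<close>

lemma closed_complex_span:
  fixes B :: "'a::chilbert_space set"
  assumes "finite B"
  shows "closed (complex_vector.span B)"
  using assms
proof (induction B rule: finite_induct)
  case empty
  then show ?case by simp
next
  case (insert a B)
  let ?M = "complex_vector.span B"
  obtain P where P: "proj P" "range (app P) = ?M"
    using proj_exists[OF subspace_complex_span insert.IH] complex_vector.span_scale by metis
  have PM: "app P x = x" if "x \<in> ?M" for x
    using that P by (metis proj_app rangeE)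
  define b where "b = app (1 - P) a"
  let ?L = "range (\<lambda>c. c *\<^sub>C b)"
  have "closed ?L"
  proof (cases "b = 0")
    case False
    have "complete ?L"
    proof (rule complete_isometric_image[of "norm b"])
      show "\<forall>x\<in>UNIV. norm b * norm x \<le> norm (x *\<^sub>C b)"
        by (simp add: norm_scaleC mult.commute)
      show "complete (UNIV :: complex set)" by (simp add: complete_eq_closed)
    qed (use False in \<open>auto simp: bounded_linear_scaleC_left\<close>)
    then show ?thesis by (rule complete_imp_closed)
  qed simp
  moreover have "complex_vector.span (insert a B) = app (1 - P) -` ?L"
  proof (intro equalityI subsetI)
    fix x assume "x \<in> complex_vector.span (insert a B)"
    then obtain c where c: "x - c *\<^sub>C a \<in> ?M"
      by (auto simp: complex_vector.span_insert)
    have "app (1 - P) (x - c *\<^sub>C a) = 0"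
      using PM[OF c] by simp
    then have "app (1 - P) x = c *\<^sub>C b"
      by (simp only: app_diff app_scaleC b_def right_minus_eq)
    then show "x \<in> app (1 - P) -` ?L" by (intro vimageI[OF refl]) (metis rangeI)
  next
    fix x assume "x \<in> app (1 - P) -` ?L"
    then obtain c where "app (1 - P) x = c *\<^sub>C b" by auto
    then have "app (1 - P) (x - c *\<^sub>C a) = 0"
      by (simp only: app_diff app_scaleC b_def diff_self)
    then have "x - c *\<^sub>C a = app P (x - c *\<^sub>C a)" by simp
    then have "x - c *\<^sub>C a \<in> ?M" using P(2) by (metis rangeI)
    then show "x \<in> complex_vector.span (insert a B)"
      by (auto simp: complex_vector.span_insert)
  qed
  ultimately show ?case
    using continuous_on_app[OF continuous_on_id, of UNIV "1 - P"] by (simp add: closed_vimage)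
qed

text \<open>A unit vector orthogonal to a finite set has distance at least \<open>1\<close> from
  each of its points. So a finite net of the unit ball with mesh below \<open>1\<close> would span
  the space.\<close>

lemma not_cpt_one:
  assumes "infinite_dimensional TYPE('a::chilbert_space)"
  shows "\<not> cpt (1 :: 'a op)"
proof
  assume "cpt (1 :: 'a op)"
  then obtain F :: "'a set" where F: "finite F" "\<And>x. norm x \<le> 1 \<Longrightarrow> \<exists>a\<in>F. dist a x < 1"
    using cpt_finite_cover[of 1 1] by auto
  let ?M = "complex_vector.span F"
  obtain P where P: "proj P" "range (app P) = ?M"
    using proj_exists[OF subspace_complex_span closed_complex_span[OF F(1)]] complex_vector.span_scale by metis
  have "?M = UNIV"
  proof (rule ccontr)
    assume "?M \<noteq> UNIV"
    then obtain v where v: "v \<notin> ?M" by blast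
    define w where "w = app (1 - P) v"
    have "w \<noteq> 0" using v P(2) by (auto simp: w_def)
    define u where "u = inverse (norm w) *\<^sub>R w"
    have u: "norm u = 1" using \<open>w \<noteq> 0\<close> by (simp add: u_def)
    have Pu: "app P u = 0"
      by (simp add: u_def w_def app_scaleR_right app_diff proj_app[OF P(1)])
    obtain a where a: "a \<in> F" "dist a u < 1" using F(2)[of u] u by auto
    have "a \<in> range (app P)" unfolding P(2) using a(1) by (rule complex_vector.span_base)
    then have Pa: "app P a = a" using proj_app[OF P(1)] by auto
    have "app (1 - P) (a - u) = - u" using Pa Pu by (simp add: app_diff)
    then have "norm u \<le> norm (a - u)"
      using norm_proj_app_le[OF proj_one_minus[OF P(1)], of "a - u"] by simp
    with a(2) u show False by (simp add: dist_norm)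
  qed
  with F(1) assms show False by (auto simp: infinite_dimensional_def)
qed

section \<open>Block triangular form modulo the compact operators\<close>

text \<open>With \<open>A = X\<^sup>* X\<close> and \<open>B = Y Y\<^sup>*\<close> the product \<open>A B\<close> is compact, so modulo compact
  operators \<open>\<bar>A - B\<bar> = A + B\<close>, and the spectral projection of \<open>A - B\<close> for the negative half line
  separates \<open>A\<close> from \<open>B\<close>.\<close>

lemma compact_product_split:
  fixes X Y E :: "'a::chilbert_space op"
  assumes E: "proj E" and XE: "X * E = X" and EY: "E * Y = Y" and XY: "cpt (X * Y)"
  obtains P where "proj P" "E * P = P" "P * E = P" "cpt (X * P)" "cpt ((E - P) * Y)"
proof -
  define A B where "A = adj X * X" and "B = Y * adj Y"
  define V C where "V = A + B" and "C = A - B"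
  have pA: "pos A" and pB: "pos B"
    using pos_adj_times[of X] pos_adj_times[of "adj Y"] by (simp_all add: A_def B_def)
  have adjA: "adj A = A" and adjB: "adj B = B"
    using pA pB by (simp_all add: pos_adj)
  have pV: "pos V" unfolding V_def using pA pB by (rule pos_plus)
  have adjC: "adj C = C" by (simp add: C_def adj_simps adjA adjB)
  have AB: "cpt (A * B)"
    unfolding A_def B_def using cpt_mult_left[OF cpt_mult_right[OF XY, of "adj Y"], of "adj X"]
    by (simp add: mult.assoc)
  have BA: "cpt (B * A)"
    using cpt_adj[OF AB] by (simp add: adj_simps adjA adjB)
  have CV: "C * C \<approx>\<^sub>K V * V"
  proof -
    have "C * C - V * V = - (A * B + A * B + (B * A + B * A))"
      by (simp add: C_def V_def algebra_simps)
    then show ?thesis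
      unfolding calkin_eq_def by (simp only:) (intro cpt_uminus cpt_plus AB BA)
  qed
  obtain Z Q where Z: "pos Z" "Z * Z = C * C"
      "\<And>S. closed_subalgebra S \<Longrightarrow> C * C \<in> S \<Longrightarrow> Z \<in> S"
    and Q: "proj Q" "C * Q = - (Z * Q)" "C * (1 - Q) = Z * (1 - Q)"
      "\<And>B. C * B = 0 \<Longrightarrow> Q * B = B"
    using sign_decomposition[OF adjC] by metis
  \<comment> \<open>\<open>C * C\<close> is congruent to \<open>V * V\<close> and hence commutes
    with \<open>V\<close> modulo compact operators; its square root \<open>Z\<close> inherits
    this.\<close>
  have ZV: "Z * V \<approx>\<^sub>K V * Z"
  proof -
    have "C * C * V \<approx>\<^sub>K V * V * V" by (intro calkin_times CV) simp
    also have "V * V * V \<approx>\<^sub>K V * (C * C)"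
      using calkin_times[OF calkin_refl[of V] calkin_sym[OF CV]] by (simp add: mult.assoc)
    finally show ?thesis
      using Z(3)[OF closed_subalgebra_calkin_commutant[of V]] by simp
  qed
  \<comment> \<open>\<open>D * (Z + V)\<close> is congruent to \<open>Z\<^sup>2 - V\<^sup>2\<close>,
    thus compact. Multiplying by \<open>D\<close> on the right gives a sum of the positive terms
    \<open>D * Z * D\<close> and \<open>D * V * D\<close>; each is then compact, and so is their
    difference \<open>D\<^sup>3\<close>. Compactness of \<open>D\<close> follows by taking
    squares.\<close>
  define D where "D = Z - V"
  have adjD: "adj D = D"
    by (simp add: D_def adj_simps pos_adj[OF Z(1)] pos_adj[OF pV])
  have "D * (Z + V) = (C * C - V * V) + (Z * V - V * Z)"
    by (simp add: D_def Z(2)[symmetric] algebra_simps)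
  then have "cpt (D * (Z + V))"
    using CV ZV by (simp add: calkin_eq_def cpt_plus)
  then have "cpt (D * (Z + V) * D)" by (rule cpt_mult_right)
  then have sum: "cpt (D * Z * D + D * V * D)" by (simp add: algebra_simps)
  have pZ: "pos (D * Z * D)" and pV': "pos (D * V * D)"
    using pos_conj[OF Z(1), of D] pos_conj[OF pV, of D] by (simp_all add: adjD)
  have "cpt (D * Z * D)" using pZ pV' sum by (rule cpt_pos_plusD)
  moreover have "cpt (D * V * D)"
    using pV' pZ sum[folded add.commute[of "D * V * D"]] by (rule cpt_pos_plusD)
  ultimately have "cpt (D * Z * D - D * V * D)" by (rule cpt_minus)
  then have "cpt (D * D * D)" by (simp add: D_def algebra_simps)
  then have "cpt (D * D * D * D)" by (rule cpt_mult_right)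
  then have "cpt (D * D)"
    by (intro cpt_squareD[of "D * D"]) (simp_all add: adj_simps adjD mult.assoc)
  with adjD have "cpt D" by (rule cpt_squareD)
  have AQ: "cpt (A * Q)"
  proof -
    \<comment> \<open>\<open>2 A = V + C\<close>, and \<open>C = - Z\<close> on \<open>Q\<close>,
      which leaves \<open>V - Z = - D\<close> there. On \<open>1 - Q\<close>,
      \<open>2 B = V - C\<close> works likewise.\<close>
    have "2 *\<^sub>R (A * Q) = C * Q + V * Q" by (simp add: V_def C_def algebra_simps scaleR_2)
    also have "\<dots> = - (D * Q)" unfolding Q(2) by (simp add: D_def algebra_simps)
    finally have "A * Q = (1/2) *\<^sub>R (- (D * Q))"
      by (metis scaleR_half_double scaleR_2 scaleR_add_right)
    then show ?thesis
      using \<open>cpt D\<close> by (simp only:) (intro cpt_scaleR cpt_uminus cpt_mult_right)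
  qed
  have BQ: "cpt (B * (1 - Q))"
  proof -
    have "2 *\<^sub>R (B * (1 - Q)) = V * (1 - Q) - C * (1 - Q)"
      by (simp add: V_def C_def algebra_simps scaleR_2)
    also have "\<dots> = - (D * (1 - Q))" unfolding Q(3) by (simp add: D_def algebra_simps)
    finally have "B * (1 - Q) = (1/2) *\<^sub>R (- (D * (1 - Q)))"
      by (metis scaleR_half_double scaleR_2 scaleR_add_right)
    then show ?thesis
      using \<open>cpt D\<close> by (simp only:) (intro cpt_scaleR cpt_uminus cpt_mult_right)
  qed
  have XQ: "cpt (X * Q)"
    using cpt_mult_left[OF AQ, of Q]
    by (rule cpt_adj_timesD[OF back_subst[of cpt]]) (simp add: adj_simps proj_adj[OF Q(1)] A_def mult.assoc)
  have "cpt (adj Y * (1 - Q))"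
    using cpt_mult_left[OF BQ, of "1 - Q"]
    by (rule cpt_adj_timesD[OF back_subst[of cpt]]) (simp add: adj_simps proj_adj[OF Q(1)] B_def mult.assoc)
  then have YQ: "cpt ((1 - Q) * Y)"
    using cpt_adj by (fastforce simp: adj_simps proj_adj[OF Q(1)])
  \<comment> \<open>\<open>Q\<close> need not lie below \<open>E\<close>. But \<open>C\<close>
    vanishes on \<open>1 - E\<close>, which the kernel clause places below \<open>Q\<close>; hence
    \<open>Q\<close> and \<open>E\<close> commute, and \<open>Q * E\<close> is the projection
    sought.\<close>
  have "C * (1 - E) = 0"
  proof -
    have "adj (E * Y) = adj Y" by (simp only: EY)
    then have "adj Y * (1 - E) = 0" by (simp add: adj_simps proj_adj[OF E] algebra_simps)
    moreover have "X * (1 - E) = 0" using XE by (simp add: algebra_simps)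
    ultimately show ?thesis
      by (simp add: C_def A_def B_def left_diff_distrib mult.assoc)
  qed
  then have 1: "Q * (1 - E) = 1 - E" by (rule Q(4))
  then have "adj (Q * (1 - E)) = adj (1 - E)" by simp
  then have "(1 - E) * Q = 1 - E"
    by (simp add: adj_simps proj_adj[OF E] proj_adj[OF Q(1)])
  with 1 have comm: "E * Q = Q * E" by (simp add: algebra_simps)
  have EQE: "E * (Q * E) = Q * E"
    by (metis comm mult.assoc proj_idem[OF E])
  show thesis
  proof (rule that[of "Q * E"])
    show "proj (Q * E)"
      unfolding proj_def
    proof
      show "adj (Q * E) = Q * E"
        by (simp add: adj_simps proj_adj[OF E] proj_adj[OF Q(1)] comm)
      show "Q * E * (Q * E) = Q * E"
        by (simp add: mult.assoc EQE proj_idem_left[OF Q(1)])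
    qed
    show "E * (Q * E) = Q * E" by (rule EQE)
    show "Q * E * E = Q * E" by (simp add: mult.assoc proj_idem[OF E])
    show "cpt (X * (Q * E))" using cpt_mult_right[OF XQ] by (simp add: mult.assoc)
    have "(E - Q * E) * Y = (1 - Q) * Y"
      by (simp add: left_diff_distrib mult.assoc EY)
    then show "cpt ((E - Q * E) * Y)" using YQ by simp
  qed
qed

section \<open>Peeling off the roots one at a time\<close>

text \<open>The newest factor stands on the right, where it meets the projection; splitting there
  yields the last diagonal block first.\<close>

primrec factor_prod :: "'a::chilbert_space op \<Rightarrow> (nat \<Rightarrow> complex) \<Rightarrow> nat \<Rightarrow> 'a op" where
  "factor_prod T \<mu> 0 = 1"
| "factor_prod T \<mu> (Suc n) = factor_prod T \<mu> n * (T - scal (\<mu> n))"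

text \<open>Members may be zero, so a block can be emptied without renumbering the roots.\<close>

definition orth_family :: "(nat \<Rightarrow> 'a::chilbert_space op) \<Rightarrow> nat \<Rightarrow> bool" where
  "orth_family P n \<longleftrightarrow> (\<forall>i<n. proj (P i)) \<and> (\<forall>i<n. \<forall>j<n. i \<noteq> j \<longrightarrow> P i * P j = 0)"

lemma orth_family_proj: "orth_family P n \<Longrightarrow> i < n \<Longrightarrow> proj (P i)"
  by (simp add: orth_family_def)

lemma orth_family_times:
  "orth_family P n \<Longrightarrow> i < n \<Longrightarrow> j < n \<Longrightarrow> P i * P j = (if i = j then P i else 0)"
  by (simp add: orth_family_def proj_idem)

lemma orth_family_sum_right:
  assumes "orth_family P n" "i < n" "I \<subseteq> {..<n}" "i \<in> I"
  shows "P i * (\<Sum>j\<in>I. P j) = P i"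
proof -
  have "P i * (\<Sum>j\<in>I. P j) = (\<Sum>j\<in>I. if i = j then P i else 0)"
    unfolding sum_distrib_left using assms
    by (intro sum.cong refl orth_family_times) auto
  also have "\<dots> = P i"
    using assms by (simp add: finite_subset[OF assms(3)])
  finally show ?thesis .
qed

lemma orth_family_sum_left:
  assumes "orth_family P n" "i < n" "I \<subseteq> {..<n}" "i \<in> I"
  shows "(\<Sum>j\<in>I. P j) * P i = P i"
proof -
  have "(\<Sum>j\<in>I. P j) * P i = (\<Sum>j\<in>I. if i = j then P i else 0)"
    unfolding sum_distrib_right using assms
    by (intro sum.cong refl) (auto simp: orth_family_times)
  also have "\<dots> = P i"
    using assms by (simp add: finite_subset[OF assms(3)])
  finally show ?thesis .
qed

text \<open>The hypothesis on \<open>(1 - E) * T * E\<close> says that \<open>E\<close> is invariant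
  modulo compact operators. Splitting off the last factor \<open>U\<close> gives a block
  \<open>E - P\<close> with \<open>(E - P) * U * E\<close> compact, which settles its diagonal entry
  and the entries to its left. \<open>P\<close> is again essentially invariant and carries the
  remaining factors.\<close>

lemma triangular_decomposition:
  fixes T E :: "'a::chilbert_space op"
  assumes "proj E" "cpt ((1 - E) * T * E)" "cpt (factor_prod T \<mu> (Suc m) * E)"
  shows "\<exists>P. orth_family P (Suc m) \<and> (\<Sum>i<Suc m. P i) = E \<and>
    (\<forall>i<Suc m. \<forall>j<i. cpt (P i * T * P j)) \<and>
    (\<forall>j<Suc m. cpt (P j * (T - scal (\<mu> j)) * P j))"
  using assms
proof (induction m arbitrary: E)
  case 0
  then have "cpt ((T - scal (\<mu> 0)) * E)" by simp
  then have "cpt (E * ((T - scal (\<mu> 0)) * E))" by (rule cpt_mult_left)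
  then show ?case
    using 0 by (intro exI[of _ "\<lambda>_. E"]) (simp add: orth_family_def mult.assoc)
next
  case (Suc m)
  note E = \<open>proj E\<close>
  define R where "R = factor_prod T \<mu> (Suc m)"
  define U where "U = T - scal (\<mu> (Suc m))"
  have RU: "cpt (R * U * E)" using Suc.prems(3) by (simp add: R_def U_def)
  have scal_block: "(1 - E) * scal a * E = 0" for a
  proof -
    have "(1 - E) * scal a * E = scal a * (1 - E) * E"
      by (simp only: scal_commute)
    then show ?thesis by (simp add: mult.assoc left_diff_distrib proj_idem[OF E])
  qed
  have EUE: "cpt ((1 - E) * U * E)"
    using Suc.prems(2) scal_block[of "\<mu> (Suc m)"] by (simp add: U_def algebra_simps)
  \<comment> \<open>Essential invariance lets the compression \<open>E * U * E\<close> replace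
    \<open>U * E\<close>, so that both factors are supported on \<open>E\<close>.\<close>
  have "R * E * (E * U * E) = R * U * E - R * ((1 - E) * U * E)"
    by (simp add: algebra_simps mult.assoc proj_idem_left[OF E])
  then have XY: "cpt (R * E * (E * U * E))"
    using cpt_minus[OF RU cpt_mult_left[OF EUE, of R]] by simp
  obtain P where P: "proj P" "E * P = P" "P * E = P"
    and RP: "cpt (R * E * P)" and UP: "cpt ((E - P) * (E * U * E))"
    by (rule compact_product_split[OF E _ _ XY])
      (simp_all add: mult.assoc proj_idem[OF E] proj_idem_left[OF E])
  have "(E - P) * E = E - P"
    by (simp add: left_diff_distrib proj_idem[OF E] P(3))
  then have UE: "cpt ((E - P) * U * E)"
    using UP by (simp only: mult.assoc[symmetric])
  have EP0: "(E - P) * P = 0"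
    by (simp add: algebra_simps P(2) proj_idem[OF P(1)])
  \<comment> \<open>The scalar in \<open>U\<close> drops out because
    \<open>(E - P) * P = 0\<close>.\<close>
  have TP: "cpt ((E - P) * T * P)"
  proof -
    have "(E - P) * scal a * P = 0" for a
    proof -
      have "(E - P) * scal a * P = scal a * (E - P) * P"
        by (simp only: scal_commute)
      then show ?thesis by (simp add: mult.assoc EP0)
    qed
    then have "(E - P) * T * P = (E - P) * U * E * P"
      by (simp add: U_def algebra_simps mult.assoc P(2))
    then show ?thesis using cpt_mult_right[OF UE, of P] by simp
  qed
  have "(1 - P) * T * P = (1 - E) * T * E * P + (E - P) * T * P"
    by (simp add: algebra_simps mult.assoc P(2))
  then have "cpt ((1 - P) * T * P)"
    using cpt_plus[OF cpt_mult_right[OF Suc.prems(2), of P] TP] by simp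
  moreover have "cpt (factor_prod T \<mu> (Suc m) * P)"
    using RP by (simp add: R_def mult.assoc P(2))
  ultimately obtain F where F: "orth_family F (Suc m)" "(\<Sum>i<Suc m. F i) = P"
    and low: "\<And>i j. i < Suc m \<Longrightarrow> j < i \<Longrightarrow> cpt (F i * T * F j)"
    and diag: "\<And>j. j < Suc m \<Longrightarrow> cpt (F j * (T - scal (\<mu> j)) * F j)"
    using Suc.IH[OF P(1)] by blast
  have FP: "F i * P = F i" "P * F i = F i" if "i < Suc m" for i
    using that orth_family_sum_right[OF F(1) that order_refl] orth_family_sum_left[OF F(1) that order_refl]
    unfolding F(2) by auto
  have projEP: "proj (E - P)"
    unfolding proj_def
    by (simp add: adj_simps proj_adj[OF E] proj_adj[OF P(1)] algebra_simps proj_idem[OF E]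
        proj_idem[OF P(1)] P(2,3))
  have FEP: "(E - P) * F i = 0" "F i * (E - P) = 0" if "i < Suc m" for i
  proof -
    have "(E - P) * F i = (E - P) * P * F i" using FP(2)[OF that] by (simp add: mult.assoc)
    then show "(E - P) * F i = 0" by (simp add: EP0)
    have "F i * (E - P) = F i * (P * (E - P))" using FP(1)[OF that] by (simp flip: mult.assoc)
    then show "F i * (E - P) = 0"
      by (simp add: right_diff_distrib P(3) proj_idem[OF P(1)])
  qed
  define G where "G = F(Suc m := E - P)"
  have GF: "G i = F i" if "i < Suc m" for i using that by (simp add: G_def)
  have Gl: "G (Suc m) = E - P" by (simp add: G_def)
  show ?case
  proof (intro exI[of _ G] conjI allI impI)
    show "orth_family G (Suc (Suc m))"
      unfolding orth_family_def
    proof (intro conjI allI impI)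
      show "proj (G i)" if "i < Suc (Suc m)" for i
        using that projEP orth_family_proj[OF F(1), of i] by (cases "i = Suc m") (auto simp: GF Gl)
      show "G i * G j = 0" if "i < Suc (Suc m)" "j < Suc (Suc m)" "i \<noteq> j" for i j
        using that FEP[of i] FEP[of j] orth_family_times[OF F(1), of i j]
        by (cases "i = Suc m"; cases "j = Suc m") (auto simp: GF Gl)
    qed
    have "(\<Sum>i<Suc m. G i) = P"
      unfolding F(2)[symmetric] by (intro sum.cong refl) (simp add: GF)
    then show "(\<Sum>i<Suc (Suc m). G i) = E"
      by (subst sum.lessThan_Suc) (simp add: Gl)
    show "cpt (G i * T * G j)" if "i < Suc (Suc m)" "j < i" for i j
    proof (cases "i = Suc m")
      case True
      with that have j: "j < Suc m" by simp
      have "G i * T * G j = (E - P) * T * P * F j"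
        using True j by (simp add: Gl GF mult.assoc FP(2))
      then show ?thesis using cpt_mult_right[OF TP] by simp
    next
      case False
      then show ?thesis using that low[of i j] by (simp add: GF)
    qed
    show "cpt (G j * (T - scal (\<mu> j)) * G j)" if "j < Suc (Suc m)" for j
    proof (cases "j = Suc m")
      case True
      have "E * (E - P) = E - P"
        by (simp add: right_diff_distrib proj_idem[OF E] P(2))
      then have "(E - P) * U * (E - P) = (E - P) * U * E * (E - P)"
        by (simp add: mult.assoc)
      then show ?thesis
        using True cpt_mult_right[OF UE, of "E - P"] by (simp add: Gl U_def)
    next
      case False
      then show ?thesis using that diag[of j] by (simp add: GF)
    qed
  qed
qed

section \<open>The essential norm\<close>

text \<open>The margin \<open>e\<close> stays because a compact perturbation of norm at most
  \<open>c\<close> itself is part of what has to be constructed.\<close>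

definition ess_le :: "'a::chilbert_space op \<Rightarrow> real \<Rightarrow> bool" where
  "ess_le X c \<longleftrightarrow> (\<forall>e>0. \<exists>K. cpt K \<and> norm (X + K) \<le> c + e)"

lemma ess_le_cong:
  assumes "X \<approx>\<^sub>K Y" "ess_le X c"
  shows "ess_le Y c"
  unfolding ess_le_def
proof (intro allI impI)
  fix e :: real assume "e > 0"
  then obtain K where K: "cpt K" "norm (X + K) \<le> c + e"
    using assms(2) unfolding ess_le_def by blast
  have "cpt ((X - Y) + K)" using assms(1) K(1) by (simp add: calkin_eq_def cpt_plus)
  moreover have "norm (Y + ((X - Y) + K)) \<le> c + e" using K(2) by simp
  ultimately show "\<exists>K. cpt K \<and> norm (Y + K) \<le> c + e" by blast
qed

lemma ess_le_adj:
  assumes "ess_le X c"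
  shows "ess_le (adj X) c"
  unfolding ess_le_def
proof (intro allI impI)
  fix e :: real assume "e > 0"
  then obtain K where K: "cpt K" "norm (X + K) \<le> c + e"
    using assms unfolding ess_le_def by blast
  then have "norm (adj X + adj K) \<le> c + e"
    using norm_adj_le[of "X + K"] by (simp add: adj_plus)
  then show "\<exists>K. cpt K \<and> norm (adj X + K) \<le> c + e"
    using cpt_adj[OF K(1)] by blast
qed

text \<open>The operator \<open>F\<close> is the positive part of \<open>X\<^sup>* X - c\<^sup>2\<close>.\<close>

lemma ess_le_compact_defect:
  fixes X :: "'a::chilbert_space op"
  assumes X: "ess_le X c" and c: "0 \<le> c"
  obtains F where "pos F" "cpt F" "\<And>x. (norm (app X x))\<^sup>2 \<le> c\<^sup>2 * (norm x)\<^sup>2 + inner (app F x) x"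
proof -
  define C where "C = adj X * X - (c\<^sup>2) *\<^sub>R 1"
  have adjC: "adj C = C" by (simp add: C_def adj_simps)
  have inner_C: "inner (app C x) x = (norm (app X x))\<^sup>2 - c\<^sup>2 * (norm x)\<^sup>2" for x
    by (simp add: C_def inner_diff_left inner_adj_left power2_norm_eq_inner)
  obtain Z Q where Z: "pos Z" and Q: "proj Q" "Z * Q = Q * Z" "C * Q = - (Z * Q)"
      "C * (1 - Q) = Z * (1 - Q)"
    using sign_decomposition[OF adjC] by metis
  let ?R = "1 - Q"
  have R: "proj ?R" using Q(1) by (rule proj_one_minus)
  have ZR: "?R * Z = Z * ?R" using Q(2) by (simp add: algebra_simps)
  define F where "F = ?R * Z * ?R"
  have F_alt: "F = C * ?R" unfolding F_def ZR Q(4) by (simp add: mult.assoc proj_idem[OF R])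
  have F_alt2: "F = ?R * C * ?R" unfolding F_def mult.assoc Q(4) ..
  have pF: "pos F"
    unfolding F_def using pos_conj[OF Z, of ?R] by (simp only: proj_adj[OF R])
  have F_le: "inner (app C x) x \<le> inner (app F x) x" for x
  proof -
    have "F - C = Z * Q" unfolding F_alt using Q(3) by (simp add: algebra_simps)
    also have "\<dots> = adj Q * Z * Q"
      using Q(2) by (simp add: proj_adj[OF Q(1)] mult.assoc proj_idem[OF Q(1)])
        (metis mult.assoc proj_idem[OF Q(1)])
    finally have "pos (F - C)" using pos_conj[OF Z, of Q] by simp
    from pos_inner[OF this, of x] show ?thesis by (simp add: inner_diff_left)
  qed
  \<comment> \<open>On the range of \<open>?R\<close> the form of \<open>F\<close> is that of
    \<open>C\<close>. A perturbation \<open>X + K\<close> of norm at most \<open>c + d\<close>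
    bounds it by a small multiple of \<open>(norm x)\<^sup>2\<close> plus a term containing the
    compact \<open>K\<close>.\<close>
  have "cpt F"
  proof (rule cpt_square_dominated)
    fix e :: real assume e: "0 < e"
    define f where "f = norm F + 1"
    have f: "f > 0" "norm F \<le> f" by (simp_all add: f_def add_nonneg_pos)
    \<comment> \<open>\<open>d \<le> 1\<close> gives
      \<open>(c + d)\<^sup>2 - c\<^sup>2 \<le> (2 * c + 1) * d\<close>, and the other bound makes
      \<open>f\<close> times this at most \<open>e\<close>.\<close>
    define d where "d = min 1 (e / ((2 * c + 1) * f))"
    have d: "0 < d" "d \<le> 1" using e c f by (auto simp: d_def)
    have "d \<le> e / ((2 * c + 1) * f)" by (simp add: d_def)
    then have df: "f * ((2 * c + 1) * d) \<le> e"
      using c f by (simp add: pos_le_divide_eq mult_ac)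
    obtain K where K: "cpt K" "norm (X + K) \<le> c + d"
      using X d(1) unfolding ess_le_def by blast
    define k where "k = 2 * (c + d) + norm K"
    have k: "0 \<le> k" using c d by (simp add: k_def)
    define M where "M = (f * k) *\<^sub>R (K * ?R)"
    show "\<exists>L M. cpt L \<and> cpt M \<and>
      (\<forall>x. (norm (app F x))\<^sup>2 \<le> e * (norm x)\<^sup>2 + norm x * (norm (app L x) + norm (app M x)))"
    proof (intro exI conjI allI)
      show "cpt M" unfolding M_def by (intro cpt_scaleR cpt_mult_right K(1))
      show "cpt 0" by (rule cpt_zero)
      fix x
      define y where "y = app ?R x"
      have y: "norm y \<le> norm x" unfolding y_def by (rule norm_proj_app_le[OF R])
      have "norm (app X y) \<le> norm (app (X + K) y) + norm (app K y)"
        using norm_triangle_ineq4[of "app (X + K) y" "app K y"] by simp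
      also have "\<dots> \<le> (c + d) * norm y + norm (app K y)"
        using norm_app[of "X + K" y] mult_right_mono[OF K(2) norm_ge_zero[of y]] by linarith
      finally have "(norm (app X y))\<^sup>2 \<le> ((c + d) * norm y + norm (app K y))\<^sup>2"
        by (intro power_mono) auto
      also have "\<dots> = (c + d)\<^sup>2 * (norm y)\<^sup>2 + norm (app K y) * (2 * (c + d) * norm y + norm (app K y))"
        by (simp add: power2_eq_square algebra_simps)
      also have "\<dots> \<le> (c + d)\<^sup>2 * (norm y)\<^sup>2 + norm (app K y) * (2 * (c + d) * norm y + norm K * norm y)"
        by (intro add_left_mono mult_left_mono norm_app) simp
      finally have Xy: "(norm (app X y))\<^sup>2 \<le> (c + d)\<^sup>2 * (norm y)\<^sup>2 + k * norm (app K y) * norm y"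
        by (simp add: k_def algebra_simps)
      have "(c + d)\<^sup>2 - c\<^sup>2 = 2 * c * d + d * d" by (simp add: power2_eq_square algebra_simps)
      also have "\<dots> \<le> (2 * c + 1) * d" using d mult_right_mono[of d 1 d] by (simp add: algebra_simps)
      finally have cd: "(c + d)\<^sup>2 - c\<^sup>2 \<le> (2 * c + 1) * d" .
      have "inner (app F x) x = inner (app C y) y"
        unfolding F_alt2 y_def using inner_proj[OF R] by (simp only: app_times)
      also have "\<dots> \<le> ((c + d)\<^sup>2 - c\<^sup>2) * (norm y)\<^sup>2 + k * norm (app K y) * norm y"
        using Xy by (simp add: inner_C algebra_simps)
      also have "\<dots> \<le> ((2 * c + 1) * d) * (norm x)\<^sup>2 + k * norm (app K y) * norm x"
        using cd y k c d by (intro add_mono mult_mono power_mono mult_nonneg_nonneg) auto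
      finally have Fx: "inner (app F x) x \<le> ((2 * c + 1) * d) * (norm x)\<^sup>2 + k * norm (app K y) * norm x" .
      have Mx: "norm (app M x) = f * k * norm (app K y)"
        using f(1) k by (simp add: M_def y_def abs_mult)
      have "(norm (app F x))\<^sup>2 \<le> norm F * inner (app F x) x"
        using pF by (rule norm_square_pos_le)
      also have "\<dots> \<le> f * inner (app F x) x"
        using f(2) pos_inner[OF pF] by (intro mult_right_mono)
      also have "\<dots> \<le> f * (((2 * c + 1) * d) * (norm x)\<^sup>2 + k * norm (app K y) * norm x)"
        using f(1) Fx by (intro mult_left_mono) auto
      also have "\<dots> = f * ((2 * c + 1) * d) * (norm x)\<^sup>2 + norm x * norm (app M x)"
        using Mx by (simp add: algebra_simps)
      also have "\<dots> \<le> e * (norm x)\<^sup>2 + norm x * norm (app M x)"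
        using df by (intro add_right_mono mult_right_mono) auto
      finally show "(norm (app F x))\<^sup>2 \<le> e * (norm x)\<^sup>2 + norm x * (norm (app M x) + norm (app 0 x))"
        by simp
    qed
  qed
  moreover have "(norm (app X x))\<^sup>2 \<le> c\<^sup>2 * (norm x)\<^sup>2 + inner (app F x) x" for x
    using F_le[of x] by (simp add: inner_C)
  ultimately show thesis using that pF by blast
qed

text \<open>Up to compact errors, \<open>X\<close> stretches \<open>y = app P x\<close> by at most
  \<open>c\<close>, while the component of its image in \<open>P\<close> already has length
  \<open>cmod \<mu> * norm y\<close>. Pythagoras bounds the remaining component. If
  \<open>cmod \<mu> > c\<close> this makes the block compact, if \<open>cmod \<mu> = c\<close> the
  rest of the column.\<close>

lemma diagonal_block_bound:
  fixes X P :: "'a::chilbert_space op"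
  assumes X: "ess_le X c" and c: "0 \<le> c" and P: "proj P" and diag: "cpt (P * (X - scal \<mu>) * P)"
  obtains L M where "cpt L" "cpt M"
    "\<And>x. (norm (app ((1 - P) * X * P) x))\<^sup>2 + ((cmod \<mu>)\<^sup>2 - c\<^sup>2) * (norm (app P x))\<^sup>2
       \<le> norm x * (norm (app L x) + norm (app M x))"
proof -
  obtain F where F: "pos F" "cpt F"
    "\<And>x. (norm (app X x))\<^sup>2 \<le> c\<^sup>2 * (norm x)\<^sup>2 + inner (app F x) x"
    using ess_le_compact_defect[OF X c] by metis
  define L where "L = P * (X - scal \<mu>) * P"
  define M where "M = (2 * cmod \<mu>) *\<^sub>R L"
  show thesis
  proof (rule that)
    show "cpt (F * P)" using F(2) by (rule cpt_mult_right)
    show "cpt M" unfolding M_def L_def by (intro cpt_scaleR diag)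
    fix x
    define y where "y = app P x"
    have y: "norm y \<le> norm x" unfolding y_def by (rule norm_proj_app_le[OF P])
    have Py: "app P y = y" by (simp add: y_def proj_app[OF P])
    have split: "app P (app X y) = \<mu> *\<^sub>C y + app L x"
      by (simp add: L_def y_def[symmetric] app_diff app_scaleC Py)
    have "norm (\<mu> *\<^sub>C y) \<le> norm (app P (app X y)) + norm (app L x)"
      using norm_triangle_ineq4[of "app P (app X y)" "app L x"] by (simp add: split)
    then have "(norm (\<mu> *\<^sub>C y))\<^sup>2 \<le> (norm (app P (app X y)) + norm (app L x))\<^sup>2"
      by (intro power_mono) auto
    moreover have "(norm (app P (app X y)))\<^sup>2 \<ge> (norm (\<mu> *\<^sub>C y))\<^sup>2 - 2 * (norm (\<mu> *\<^sub>C y) * norm (app L x))"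
    proof -
      have "(norm (app P (app X y)))\<^sup>2
          = (norm (\<mu> *\<^sub>C y))\<^sup>2 + 2 * inner (\<mu> *\<^sub>C y) (app L x) + (norm (app L x))\<^sup>2"
        by (simp add: split power2_norm_eq_inner inner_add inner_commute)
      moreover have "- inner (\<mu> *\<^sub>C y) (app L x) \<le> norm (\<mu> *\<^sub>C y) * norm (app L x)"
        using Cauchy_Schwarz_ineq2[of "\<mu> *\<^sub>C y" "app L x"] by linarith
      moreover have "0 \<le> (norm (app L x))\<^sup>2" by simp
      ultimately show ?thesis by linarith
    qed
    moreover have "norm (\<mu> *\<^sub>C y) * norm (app L x) \<le> cmod \<mu> * norm x * norm (app L x)"
      using y by (simp add: norm_scaleC mult_left_mono mult_right_mono)
    ultimately have low: "(cmod \<mu>)\<^sup>2 * (norm y)\<^sup>2 - norm x * norm (app M x) \<le> (norm (app P (app X y)))\<^sup>2"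
      by (simp add: norm_scaleC power_mult_distrib M_def algebra_simps)
    have "inner (app F y) y \<le> norm (app F y) * norm y" by (rule norm_cauchy_schwarz)
    also have "\<dots> \<le> norm (app F y) * norm x" using y by (intro mult_left_mono) auto
    finally have "(norm (app X y))\<^sup>2 \<le> c\<^sup>2 * (norm y)\<^sup>2 + norm x * norm (app (F * P) x)"
      using F(3)[of y] by (simp add: y_def mult.commute)
    moreover have "(norm (app X y))\<^sup>2 = (norm (app P (app X y)))\<^sup>2 + (norm (app ((1 - P) * X * P) x))\<^sup>2"
      using proj_pythagoras[OF P, of "app X y"] by (simp add: y_def)
    ultimately show "(norm (app ((1 - P) * X * P) x))\<^sup>2 + ((cmod \<mu>)\<^sup>2 - c\<^sup>2) * (norm (app P x))\<^sup>2
       \<le> norm x * (norm (app (F * P) x) + norm (app M x))"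
      using low by (simp add: y_def[symmetric] algebra_simps)
  qed
qed

lemma cpt_large_eigenvalue_block:
  fixes X P :: "'a::chilbert_space op"
  assumes X: "ess_le X c" and c: "0 \<le> c" and P: "proj P" and diag: "cpt (P * (X - scal \<mu>) * P)"
    and \<mu>: "c < cmod \<mu>"
  shows "cpt P"
proof -
  obtain L M where LM: "cpt L" "cpt M" and
    bound: "\<And>x. (norm (app ((1 - P) * X * P) x))\<^sup>2 + ((cmod \<mu>)\<^sup>2 - c\<^sup>2) * (norm (app P x))\<^sup>2
       \<le> norm x * (norm (app L x) + norm (app M x))"
    using diagonal_block_bound[OF X c P diag] by metis
  define \<delta> where "\<delta> = (cmod \<mu>)\<^sup>2 - c\<^sup>2"
  have \<delta>: "\<delta> > 0" using c \<mu> by (simp add: \<delta>_def power_strict_mono)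
  show ?thesis
  proof (rule cpt_square_dominated, intro exI conjI allI)
    show "cpt (inverse \<delta> *\<^sub>R L)" "cpt (inverse \<delta> *\<^sub>R M)" by (intro cpt_scaleR LM)+
    fix e :: real and x :: 'a assume e: "0 < e"
    have "0 \<le> (norm (app ((1 - P) * X * P) x))\<^sup>2" by simp
    then have "\<delta> * (norm (app P x))\<^sup>2 \<le> norm x * (norm (app L x) + norm (app M x))"
      using bound[of x] unfolding \<delta>_def by linarith
    then have "(norm (app P x))\<^sup>2 \<le> inverse \<delta> * (norm x * (norm (app L x) + norm (app M x)))"
      using \<delta> by (simp add: field_simps)
    moreover have "0 \<le> e * (norm x)\<^sup>2" using e by simp
    moreover have "norm x * (norm (app (inverse \<delta> *\<^sub>R L) x) + norm (app (inverse \<delta> *\<^sub>R M) x))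
        = inverse \<delta> * (norm x * (norm (app L x) + norm (app M x)))"
      using \<delta> by (simp add: algebra_simps)
    ultimately show "(norm (app P x))\<^sup>2 \<le> e * (norm x)\<^sup>2 +
        norm x * (norm (app (inverse \<delta> *\<^sub>R L) x) + norm (app (inverse \<delta> *\<^sub>R M) x))"
      by linarith
  qed
qed

lemma cpt_extremal_eigenvalue_block:
  fixes X P :: "'a::chilbert_space op"
  assumes X: "ess_le X c" and P: "proj P" and diag: "cpt (P * (X - scal \<mu>) * P)"
    and \<mu>: "cmod \<mu> = c"
  shows "cpt ((1 - P) * X * P)"
proof -
  have c: "0 \<le> c" using \<mu> by auto
  obtain L M where LM: "cpt L" "cpt M" and
    bound: "\<And>x. (norm (app ((1 - P) * X * P) x))\<^sup>2 + ((cmod \<mu>)\<^sup>2 - c\<^sup>2) * (norm (app P x))\<^sup>2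
       \<le> norm x * (norm (app L x) + norm (app M x))"
    using diagonal_block_bound[OF X c P diag] by metis
  show ?thesis
  proof (rule cpt_square_dominated, intro exI conjI allI)
    show "cpt L" "cpt M" by (fact LM)+
    fix e :: real and x :: 'a assume e: "0 < e"
    then have "0 \<le> e * (norm x)\<^sup>2" by simp
    then show "(norm (app ((1 - P) * X * P) x))\<^sup>2 \<le> e * (norm x)\<^sup>2 +
        norm x * (norm (app L x) + norm (app M x))"
      using bound[of x] \<mu> by simp
  qed
qed

text \<open>The row of \<open>X\<close> is the adjoint of a column of \<open>adj X\<close>, whose
  diagonal entry \<open>cnj \<mu>\<close> has the same modulus.\<close>

lemma cpt_extremal_eigenvalue_block':
  fixes X P :: "'a::chilbert_space op"
  assumes X: "ess_le X c" and P: "proj P" and diag: "cpt (P * (X - scal \<mu>) * P)"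
    and \<mu>: "cmod \<mu> = c"
  shows "cpt (P * X * (1 - P))"
proof -
  have "cpt ((1 - P) * adj X * P)"
  proof (rule cpt_extremal_eigenvalue_block[OF ess_le_adj[OF X] P])
    show "cpt (P * (adj X - scal (cnj \<mu>)) * P)"
      using cpt_adj[OF diag] by (simp add: adj_simps proj_adj[OF P] mult.assoc)
  qed (use \<mu> in simp)
  from cpt_adj[OF this] show ?thesis
    by (simp add: adj_simps proj_adj[OF P] mult.assoc)
qed

section \<open>Lifting and norm reduction\<close>

text \<open>\<open>S - scal (\<mu> k)\<close> maps the first \<open>k + 1\<close> blocks into the
  first \<open>k\<close>; by induction the product of the first \<open>k\<close> factors annihilates
  the first \<open>k\<close> blocks.\<close>

lemma factor_prod_triangular_eq_0:
  assumes P: "orth_family P n" and sum: "(\<Sum>i<n. P i) = 1"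
    and low: "\<And>i j. i < n \<Longrightarrow> j < i \<Longrightarrow> P i * S * P j = 0"
    and diag: "\<And>j. j < n \<Longrightarrow> P j * S * P j = scal (\<mu> j) * P j"
  shows "factor_prod S \<mu> n = 0"
proof -
  have "factor_prod S \<mu> k * (\<Sum>i<k. P i) = 0" if "k \<le> n" for k
    using that
  proof (induction k)
    case (Suc k)
    then have k: "k < n" by simp
    let ?U = "S - scal (\<mu> k)" and ?E = "\<lambda>k. \<Sum>i<k. P i"
    \<comment> \<open>Rows \<open>i \<ge> k\<close> and columns \<open>j \<le> k\<close> meet only
      below the diagonal or in the diagonal block \<open>k\<close>, where the scalar
      cancels.\<close>
    have block: "P i * ?U * P j = 0" if i: "i \<in> {k..<n}" and j: "j \<in> {..<Suc k}" for i j
    proof -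
      have ij: "i < n" "j < n" "j < i \<or> i = j \<and> j = k" using i j k by auto
      have "P i * ?U * P j = P i * S * P j - P i * scal (\<mu> k) * P j"
        by (simp add: algebra_simps)
      also have "P i * scal (\<mu> k) * P j = scal (\<mu> k) * P i * P j"
        by (simp only: scal_commute)
      also have "P i * S * P j - scal (\<mu> k) * P i * P j = 0"
        using ij low[of i j] diag[of k] orth_family_times[OF P ij(1,2)] by (auto simp: mult.assoc)
      finally show ?thesis .
    qed
    have "1 - ?E k = (\<Sum>i\<in>{k..<n}. P i)"
      using sum sum.atLeastLessThan_concat[of 0 k n P] k by (simp add: atLeast0LessThan algebra_simps)
    then have "(1 - ?E k) * ?U * ?E (Suc k) = (\<Sum>i\<in>{k..<n}. \<Sum>j\<in>{..<Suc k}. P i * ?U * P j)"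
      by (simp only: sum_distrib_right sum_distrib_left) (rule sum.swap)
    also have "\<dots> = 0" using block by (intro sum.neutral ballI) blast
    finally have "?U * ?E (Suc k) = ?E k * (?U * ?E (Suc k))"
      by (simp add: left_diff_distrib mult.assoc del: sum.lessThan_Suc)
    then have "factor_prod S \<mu> (Suc k) * ?E (Suc k) = factor_prod S \<mu> k * ?E k * (?U * ?E (Suc k))"
      by (metis factor_prod.simps(2) mult.assoc)
    then show ?case using Suc by simp
  qed simp
  from this[OF order_refl] show ?thesis by (simp add: sum)
qed

lemma orth_family_sum_times_sum:
  assumes P: "orth_family P n" and I: "I \<subseteq> {..<n}" "K \<subseteq> {..<n}"
  shows "(\<Sum>i\<in>I. P i) * (\<Sum>k\<in>K. P k) = (\<Sum>i\<in>I \<inter> K. P i)"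
proof -
  have fin: "finite I" "finite K" using I finite_subset by auto
  have "(\<Sum>i\<in>I. P i) * (\<Sum>k\<in>K. P k) = (\<Sum>i\<in>I. \<Sum>k\<in>K. P i * P k)"
    by (simp only: sum_distrib_right sum_distrib_left) (rule sum.swap)
  also have "\<dots> = (\<Sum>i\<in>I. \<Sum>k\<in>K. if i = k then P i else 0)"
    using I by (intro sum.cong refl orth_family_times[OF P]) auto
  also have "\<dots> = (\<Sum>i\<in>I. if i \<in> K then P i else 0)"
    using fin by (simp add: sum.delta)
  also have "\<dots> = (\<Sum>i\<in>I \<inter> K. P i)"
    using fin by (simp add: sum.inter_restrict)
  finally show ?thesis .
qed

lemma orth_family_group:
  assumes P: "orth_family P n" and I: "\<And>j. j < m \<Longrightarrow> I j \<subseteq> {..<n}"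
    and disj: "\<And>i j. i < m \<Longrightarrow> j < m \<Longrightarrow> i \<noteq> j \<Longrightarrow> I i \<inter> I j = {}"
  shows "orth_family (\<lambda>j. \<Sum>i\<in>I j. P i) m"
  unfolding orth_family_def
proof (intro conjI allI impI)
  fix i assume i: "i < m"
  have adj_sum: "adj (sum P K) = (\<Sum>i\<in>K. adj (P i))" for K
    by (induction K rule: infinite_finite_induct) (simp_all add: adj_plus)
  have "adj (P j) = P j" if "j \<in> I i" for j
    using orth_family_proj[OF P] that I[OF i] proj_adj by blast
  then show "proj (\<Sum>j\<in>I i. P j)"
    using orth_family_sum_times_sum[OF P I[OF i] I[OF i]] by (simp add: proj_def adj_sum)
  fix j assume j: "j < m" "i \<noteq> j"
  then show "(\<Sum>k\<in>I i. P k) * (\<Sum>k\<in>I j. P k) = 0"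
    using orth_family_sum_times_sum[OF P I[OF i] I[OF j(1)]] disj[OF i j] by simp
qed

text \<open>A compact block may carry an eigenvalue of modulus larger than the essential norm, so such
  blocks have to be merged into another one.\<close>

lemma orth_family_absorb_compact:
  assumes P: "orth_family P n" and sum: "(\<Sum>i<n. P i) = 1"
    and B: "B \<subseteq> {..<n}" and cpt: "\<And>i. i \<in> B \<Longrightarrow> cpt (P i)"
    and k: "k < n" "k \<notin> B"
  obtains P' where "orth_family P' n" "(\<Sum>i<n. P' i) = 1" "\<And>i. i \<in> B \<Longrightarrow> P' i = 0"
    "\<And>i. i < n \<Longrightarrow> P' i \<approx>\<^sub>K P i"
proof -
  \<comment> \<open>\<open>I j\<close> lists the old blocks put into slot \<open>j\<close>: slot
    \<open>k\<close> receives those of \<open>B\<close>, whose own slots become empty. Slots keep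
    their numbers, hence their roots.\<close>
  define I where "I j = (if j \<in> B then {} else if j = k then insert k B else {j})" for j
  define P' where "P' j = (\<Sum>i\<in>I j. P i)" for j
  have finB: "finite B" using B finite_subset by auto
  have I: "I j \<subseteq> {..<n}" if "j < n" for j using that B by (auto simp: I_def)
  have disj: "I i \<inter> I j = {}" if "i \<noteq> j" for i j using that k(2) by (auto simp: I_def)
  have union: "(\<Union>j<n. I j) = {..<n}"
  proof
    show "(\<Union>j<n. I j) \<subseteq> {..<n}" using I by blast
    show "{..<n} \<subseteq> (\<Union>j<n. I j)"
    proof
      fix i assume "i \<in> {..<n}"
      then show "i \<in> (\<Union>j<n. I j)"
        using k by (cases "i \<in> B") (auto simp: I_def intro: bexI[of _ k] bexI[of _ i])
    qed
  qed
  show thesis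
  proof (rule that)
    show "orth_family P' n"
      unfolding P'_def[abs_def] by (rule orth_family_group[OF P I disj])
    have "(\<Sum>j<n. P' j) = (\<Sum>i\<in>(\<Union>j<n. I j). P i)"
      unfolding P'_def
      by (rule sum.UNION_disjoint[symmetric]) (use disj finB in \<open>auto simp: I_def\<close>)
    then show "(\<Sum>i<n. P' i) = 1" by (simp add: union sum)
    show "P' i = 0" if "i \<in> B" for i using that by (simp add: P'_def I_def)
    show "P' i \<approx>\<^sub>K P i" if "i < n" for i
    proof -
      consider "i \<in> B" | "i = k" | "i \<notin> B" "i \<noteq> k" by blast
      then show ?thesis
      proof cases
        case 1
        then show ?thesis using cpt_uminus[OF cpt] by (simp add: P'_def I_def calkin_eq_def)
      next
        case 2
        have "P' k - P k = (\<Sum>i\<in>B. P i)"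
          using k finB by (simp add: P'_def I_def)
        then show ?thesis
          using 2 cpt by (simp add: calkin_eq_def cpt_sum)
      next
        case 3
        then show ?thesis by (simp add: P'_def I_def)
      qed
    qed
  qed
qed

section \<open>Norm estimates for block operators\<close>

lemma orth_family_pythagoras:
  assumes P: "orth_family P n" and sum: "(\<Sum>i<n. P i) = 1"
  shows "(norm x)\<^sup>2 = (\<Sum>i<n. (norm (app (P i) x))\<^sup>2)"
proof -
  have "(norm x)\<^sup>2 = inner (app (\<Sum>i<n. P i) x) x"
    by (simp add: sum power2_norm_eq_inner)
  also have "\<dots> = (\<Sum>i<n. inner (app (P i) x) x)"
    by (simp only: sum_app inner_sum_left)
  also have "\<dots> = (\<Sum>i<n. (norm (app (P i) x))\<^sup>2)"
    by (intro sum.cong refl proj_inner_self orth_family_proj[OF P]) auto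
  finally show ?thesis .
qed

text \<open>With \<open>F = R\<^sup>2\<close> the form is \<open>(norm (app R x))\<^sup>2\<close>,
  and Cauchy-Schwarz for a sum of \<open>card G\<close> vectors applies. At the price of this
  factor, \<open>F\<close> is bounded by its block diagonal part, which commutes with the
  projections.\<close>

lemma pos_pinching_le:
  fixes F :: "'a::chilbert_space op"
  assumes F: "pos F" and G: "finite G"
  shows "inner (app F (\<Sum>i\<in>G. z i)) (\<Sum>i\<in>G. z i) \<le> real (card G) * (\<Sum>i\<in>G. inner (app F (z i)) (z i))"
proof -
  obtain R where R: "pos R" "R * R = F"
    using pos_sqrt_exists[OF F] by metis
  have sq: "inner (app F x) x = (norm (app R x))\<^sup>2" for x
    unfolding R(2)[symmetric] power2_norm_eq_inner by (metis app_times inner_adj_left pos_adj[OF R(1)])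
  have "norm (app R (\<Sum>i\<in>G. z i)) \<le> (\<Sum>i\<in>G. norm (app R (z i)))"
    unfolding app_sum by (rule norm_sum)
  then have "(norm (app R (\<Sum>i\<in>G. z i)))\<^sup>2 \<le> (\<Sum>i\<in>G. norm (app R (z i)))\<^sup>2"
    by (rule power_mono) simp
  also have "\<dots> \<le> (\<Sum>i\<in>G. (norm (app R (z i)))\<^sup>2) * card G"
    by (rule sum_squared_le_sum_of_squares)
  finally show ?thesis by (simp add: sq mult.commute)
qed

text \<open>The row \<open>(J, V)\<close> is a contraction, since its adjoint, sending
  \<open>w\<close> to \<open>(J w, V w)\<close>, is isometric.\<close>

lemma norm_contractive_combination:
  assumes adjJ: "adj J = J" and adjV: "adj V = V" and JV: "J * J + V * V = 1"
  shows "(norm (app J a + app V b))\<^sup>2 \<le> (norm a)\<^sup>2 + (norm b)\<^sup>2"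
proof (cases "app J a + app V b = 0")
  case False
  define w where "w = app J a + app V b"
  have "inner (app (J * J + V * V) w) w = (norm w)\<^sup>2"
    by (simp add: JV power2_norm_eq_inner)
  then have w: "(norm (app J w))\<^sup>2 + (norm (app V w))\<^sup>2 = (norm w)\<^sup>2"
    using inner_adj_left[of J "app J w" w] inner_adj_left[of V "app V w" w]
    by (simp add: adjJ adjV inner_add_left power2_norm_eq_inner)
  have "(norm w)\<^sup>2 = inner (app J a + app V b) w"
    by (simp add: w_def power2_norm_eq_inner)
  also have "\<dots> = inner a (app J w) + inner b (app V w)"
    using inner_adj_left[of J a w] inner_adj_left[of V b w]
    by (simp add: adjJ adjV inner_add_left)
  also have "\<dots> \<le> norm a * norm (app J w) + norm b * norm (app V w)"
    by (intro add_mono norm_cauchy_schwarz)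
  finally have "((norm w)\<^sup>2)\<^sup>2 \<le> (norm a * norm (app J w) + norm b * norm (app V w))\<^sup>2"
    by (rule power_mono) simp
  also have "\<dots> \<le> ((norm a)\<^sup>2 + (norm b)\<^sup>2) * ((norm (app J w))\<^sup>2 + (norm (app V w))\<^sup>2)"
  proof -
    have "0 \<le> (norm a * norm (app V w) - norm b * norm (app J w))\<^sup>2" by simp
    then show ?thesis by (simp add: power2_eq_square algebra_simps)
  qed
  finally have "(norm w)\<^sup>2 * (norm w)\<^sup>2 \<le> ((norm a)\<^sup>2 + (norm b)\<^sup>2) * (norm w)\<^sup>2"
    unfolding w power2_eq_square[of "(norm w)\<^sup>2"] .
  then show ?thesis
    unfolding w_def by (rule mult_right_le_imp_le) (use False in simp)
qed simp

lemma block_diagonal_times: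
  assumes P: "orth_family P n" and j: "j < n"
  shows "P j * (\<Sum>i<n. scal (\<mu> i) * P i) = scal (\<mu> j) * P j"
proof -
  have "P j * (scal (\<mu> i) * P i) = (if i = j then scal (\<mu> j) * P j else 0)" if "i < n" for i
  proof -
    have "P j * (scal (\<mu> i) * P i) = scal (\<mu> i) * P j * P i"
      by (simp only: mult.assoc[symmetric] scal_commute)
    then show ?thesis using orth_family_times[OF P j that] by (auto simp: mult.assoc)
  qed
  then show ?thesis
    using j by (simp add: sum_distrib_left)
qed

text \<open>Write \<open>S = D + N\<close> with block diagonal part \<open>D\<close>.  On the blocks with \<open>\<bar>\<mu> j\<bar> < c\<close> the excess of
  \<open>S\<^sup>* S\<close> over \<open>c\<^sup>2\<close> is dominated by \<open>\<kappa> H\<close> with \<open>H\<close> compact and block diagonal, and for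
  \<open>J = (1 + H)\<^sup>-\<^sup>1\<close> and \<open>V\<^sup>2 = 1 - J\<^sup>2\<close> the operator \<open>D + J N J = J S J + V D V\<close> is the required
  perturbation: it is a compression of \<open>S \<oplus> D\<close>.\<close>

lemma norm_reduction:
  fixes S :: "'a::chilbert_space op"
  assumes P: "orth_family P n" and sum: "(\<Sum>i<n. P i) = 1" and c: "0 \<le> c"
    and small: "\<And>j. j < n \<Longrightarrow> P j = 0 \<or> cmod (\<mu> j) \<le> c"
    and low: "\<And>i j. i < n \<Longrightarrow> j < i \<Longrightarrow> P i * S * P j = 0"
    and diag: "\<And>j. j < n \<Longrightarrow> P j * S * P j = scal (\<mu> j) * P j"
    and reducing: "\<And>i j. i < n \<Longrightarrow> j < n \<Longrightarrow> i \<noteq> j \<Longrightarrow> c \<le> cmod (\<mu> i) \<or> c \<le> cmod (\<mu> j) \<Longrightarrow>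
        P i * S * P j = 0"
    and S: "ess_le S c"
  obtains S' where "S' \<approx>\<^sub>K S" "norm S' \<le> c"
    "\<And>i j. i < n \<Longrightarrow> j < i \<Longrightarrow> P i * S' * P j = 0"
    "\<And>j. j < n \<Longrightarrow> P j * S' * P j = scal (\<mu> j) * P j"
proof -
  obtain F where F: "pos F" "cpt F"
    "\<And>x. (norm (app S x))\<^sup>2 \<le> c\<^sup>2 * (norm x)\<^sup>2 + inner (app F x) x"
    using ess_le_compact_defect[OF S c] by metis
  \<comment> \<open>Blocks outside \<open>G\<close> are zero or have
    \<open>cmod (\<mu> j) = c\<close>: no slack, but by \<open>reducing\<close> they split off from
    the rest.\<close>
  define G where "G = {j. j < n \<and> cmod (\<mu> j) < c}"
  have G: "G \<subseteq> {..<n}" "finite G" by (auto simp: G_def)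
  \<comment> \<open>A lower bound for the slack; the inserted \<open>1\<close> covers empty
    \<open>G\<close>.\<close>
  define \<kappa> where "\<kappa> = Min (insert 1 ((\<lambda>j. c\<^sup>2 - (cmod (\<mu> j))\<^sup>2) ` G))"
  have \<kappa>: "0 < \<kappa>"
    unfolding \<kappa>_def using G(2) c by (auto simp: G_def power_strict_mono)
  have \<kappa>_le: "(cmod (\<mu> j))\<^sup>2 \<le> c\<^sup>2 - \<kappa>" if "j \<in> G" for j
  proof -
    have "\<kappa> \<le> c\<^sup>2 - (cmod (\<mu> j))\<^sup>2"
      unfolding \<kappa>_def using G(2) that by (intro Min_le) auto
    then show ?thesis by simp
  qed
  \<comment> \<open>\<open>card G\<close> is the price of \<open>pos_pinching_le\<close>. Dividing
    by \<open>\<kappa>\<close> makes \<open>\<kappa> * H\<close> the block diagonal bound for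
    \<open>F\<close>.\<close>
  define r where "r = real (card G) / \<kappa>"
  have r: "0 \<le> r" using \<kappa> by (simp add: r_def)
  define H where "H = (\<Sum>j\<in>G. r *\<^sub>R (P j * F * P j))"
  have adjP: "adj (P j) = P j" if "j < n" for j
    using orth_family_proj[OF P that] by (rule proj_adj)
  have pH: "pos H"
    unfolding H_def
  proof (intro pos_sum pos_scaleR r)
    fix j assume "j \<in> G"
    then have "adj (P j) = P j" using G(1) adjP by auto
    then show "pos (P j * F * P j)" using pos_conj[OF F(1), of "P j"] by simp
  qed
  have cH: "cpt H"
    unfolding H_def by (intro cpt_sum cpt_scaleR cpt_mult_right cpt_mult_left F(2))
  have PH: "P j * H = (if j \<in> G then r *\<^sub>R (P j * F * P j) else 0)"
    and HP: "H * P j = (if j \<in> G then r *\<^sub>R (P j * F * P j) else 0)" if j: "j < n" for j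
  proof -
    have "P j * (r *\<^sub>R (P i * F * P i)) = (if i = j then r *\<^sub>R (P j * F * P j) else 0)"
      "r *\<^sub>R (P i * F * P i) * P j = (if i = j then r *\<^sub>R (P j * F * P j) else 0)" if "i \<in> G" for i
    proof -
      have i: "i < n" using that G by auto
      have "P j * (r *\<^sub>R (P i * F * P i)) = r *\<^sub>R ((P j * P i) * F * P i)"
        "r *\<^sub>R (P i * F * P i) * P j = r *\<^sub>R (P i * F * (P i * P j))"
        by (simp_all add: mult.assoc)
      then show "P j * (r *\<^sub>R (P i * F * P i)) = (if i = j then r *\<^sub>R (P j * F * P j) else 0)"
        "r *\<^sub>R (P i * F * P i) * P j = (if i = j then r *\<^sub>R (P j * F * P j) else 0)"
        using orth_family_times[OF P j i] orth_family_times[OF P i j] by auto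
    qed
    then show "P j * H = (if j \<in> G then r *\<^sub>R (P j * F * P j) else 0)"
      "H * P j = (if j \<in> G then r *\<^sub>R (P j * F * P j) else 0)"
      using G(2) by (simp_all add: H_def sum_distrib_left sum_distrib_right)
  qed
  obtain J where J: "J * (1 + H) = 1" "(1 + H) * J = 1"
    using pos_one_plus_inverse[OF pH] by metis
  have HJ: "H * J = 1 - J" using J(2) by (simp add: distrib_right eq_diff_eq add.commute)
  have J_commute: "J * A = A * J" if "H * A = A * H" for A
  proof -
    have "J * A = J * (A * ((1 + H) * J))" by (simp add: J(2))
    also have "\<dots> = J * ((1 + H) * A) * J" using that by (simp add: algebra_simps)
    also have "\<dots> = A * J" by (simp add: mult.assoc[symmetric] J(1))
    finally show ?thesis .
  qed
  have JP: "J * P j = P j * J" if "j < n" for j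
    using PH[OF that] HP[OF that] by (intro J_commute) simp
  have adjJ: "adj J = J"
  proof -
    have "adj (J * (1 + H)) = 1" by (simp add: J(1))
    then have "(1 + H) * adj J = 1" by (simp add: adj_simps pos_adj[OF pH])
    then have "J * ((1 + H) * adj J) = J" by simp
    then show ?thesis by (simp add: mult.assoc[symmetric] J(1))
  qed
  have J_one: "J \<approx>\<^sub>K 1"
    unfolding calkin_eq_def using cpt_uminus[OF cpt_mult_right[OF cH, of J]] by (simp add: HJ)
  \<comment> \<open>In the square of \<open>x = (1 + H) (J x)\<close> the cross term contains the
    form of \<open>H\<close> twice.\<close>
  have HJ_le: "inner (app H (app J x)) (app J x) \<le> (norm x)\<^sup>2 - (norm (app J x))\<^sup>2" for x
  proof -
    have x: "x = app J x + app H (app J x)"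
      using HJ by (metis add.commute app_minus app_one app_times diff_add_cancel)
    have "(norm x)\<^sup>2 = (norm (app J x))\<^sup>2 + 2 * inner (app H (app J x)) (app J x)
        + (norm (app H (app J x)))\<^sup>2"
      by (subst x) (simp add: power2_norm_eq_inner inner_add inner_commute)
    moreover have "0 \<le> inner (app H (app J x)) (app J x)" using pH by (rule pos_inner)
    moreover have "0 \<le> (norm (app H (app J x)))\<^sup>2" by simp
    ultimately show ?thesis by linarith
  qed
  have inner_JJ: "inner (app (1 - J * J) x) x = (norm x)\<^sup>2 - (norm (app J x))\<^sup>2" for x
    using inner_adj_left[of J "app J x" x] by (simp add: adjJ inner_diff_left power2_norm_eq_inner)
  have "pos (1 - J * J)"
    unfolding pos_def inner_JJ using order_trans[OF pos_inner[OF pH] HJ_le]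
    by (simp only: adj_simps adjJ adj_one) blast
  then obtain V where V: "pos V" "V * V = 1 - J * J"
    and V_alg: "\<And>S. closed_subalgebra S \<Longrightarrow> 1 - J * J \<in> S \<Longrightarrow> V \<in> S"
    using pos_sqrt_exists by metis
  have adjV: "adj V = V" using V(1) by (rule pos_adj)
  have norm_V: "(norm (app V x))\<^sup>2 = (norm x)\<^sup>2 - (norm (app J x))\<^sup>2" for x
    unfolding inner_JJ[symmetric] V(2)[symmetric]
    using inner_adj_left[of V "app V x" x] by (simp add: adjV power2_norm_eq_inner)
  have V_commute: "V * A = A * V" if "J * A = A * J" for A
  proof -
    have "J * J * A = A * (J * J)" using that by (metis mult.assoc)
    then show ?thesis
      using V_alg[OF closed_subalgebra_commutant[of A]] by (simp add: algebra_simps)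
  qed
  have VP: "V * P j = P j * V" if "j < n" for j
    using JP[OF that] by (rule V_commute)
  \<comment> \<open>There \<open>H\<close> vanishes, so \<open>J\<close> is the identity and
    \<open>V\<close> is zero: only blocks with slack are altered.\<close>
  have VP0: "V * P j = 0" if "j < n" "j \<notin> G" for j
  proof -
    have "(1 + H) * P j = P j" using that HP[of j] by (simp add: distrib_right)
    then have "J * ((1 + H) * P j) = J * P j" by simp
    then have "J * P j = P j" by (simp add: mult.assoc[symmetric] J(1))
    then have "app J (app (P j) x) = app (P j) x" for x by (metis app_times)
    then have "norm (app V (app (P j) x)) = 0" for x
      using norm_V[of "app (P j) x"] by simp
    then show ?thesis by (intro op_eqI) simp
  qed
  define D where "D = (\<Sum>i<n. scal (\<mu> i) * P i)"
  have PD: "P j * D = scal (\<mu> j) * P j" if "j < n" for j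
    using block_diagonal_times[OF P that, of \<mu>] by (simp add: D_def)
  have JD: "J * D = D * J"
  proof -
    have "J * (scal (\<mu> i) * P i) = scal (\<mu> i) * P i * J" if "i < n" for i
      using JP[OF that] scal_commute[of J "\<mu> i"] by (metis mult.assoc)
    then show ?thesis by (simp add: D_def sum_distrib_left sum_distrib_right)
  qed
  define S' where "S' = D + J * (S - D) * J"
  \<comment> \<open>\<open>D\<close> commutes with \<open>J\<close> and \<open>V\<close>, so
    \<open>D = J * D * J + V * D * V\<close>, and the terms \<open>J * D * J\<close> cancel.\<close>
  have S'_alt: "S' = J * S * J + V * (D * V)"
  proof -
    have "V * (D * V) = D * (1 - J * J)"
      using V_commute[OF JD] V(2) by (metis mult.assoc)
    moreover have "J * D * J = D * (J * J)" using JD by (simp add: mult.assoc)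
    ultimately show ?thesis by (simp add: S'_def algebra_simps)
  qed
  \<comment> \<open>By \<open>reducing\<close>, rows in \<open>G\<close> see only the component
    \<open>E y\<close> and are controlled by \<open>F\<close>, while rows outside \<open>G\<close>
    act as the scalar \<open>\<mu> j\<close>.\<close>
  have normS: "(norm (app S y))\<^sup>2 \<le> c\<^sup>2 * (norm y)\<^sup>2 + \<kappa> * inner (app H y) y" for y
  proof -
    define E where "E = (\<Sum>i\<in>G. P i)"
    have PSE: "P j * S = P j * S * E" if j: "j \<in> G" for j
    proof -
      have jn: "j < n" using j G by auto
      have "P j * S = P j * S * (\<Sum>i<n. P i)" by (simp add: sum)
      also have "\<dots> = (\<Sum>i<n. P j * S * P i)" by (rule sum_distrib_left)
      also have "\<dots> = (\<Sum>i\<in>G. P j * S * P i)"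
      proof (rule sum.mono_neutral_right)
        show "\<forall>i\<in>{..<n} - G. P j * S * P i = 0"
        proof
          fix i assume "i \<in> {..<n} - G"
          then show "P j * S * P i = 0"
            using reducing[OF jn, of i] j by (cases "i = j") (auto simp: G_def)
        qed
      qed (use G in auto)
      also have "\<dots> = P j * S * E" by (simp add: E_def sum_distrib_left)
      finally show ?thesis .
    qed
    have PS: "P j * S = scal (\<mu> j) * P j" if j: "j < n" "j \<notin> G" for j
    proof -
      have "P j * S = P j * S * (\<Sum>i<n. P i)" by (simp add: sum)
      also have "\<dots> = (\<Sum>i<n. P j * S * P i)" by (rule sum_distrib_left)
      also have "\<dots> = (\<Sum>i\<in>{j}. P j * S * P i)"
      proof (rule sum.mono_neutral_right)
        show "\<forall>i\<in>{..<n} - {j}. P j * S * P i = 0"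
          using reducing[OF j(1)] j(2) j(1) by (auto simp: G_def)
      qed (use j in auto)
      also have "\<dots> = scal (\<mu> j) * P j" using diag[OF j(1)] by simp
      finally show ?thesis .
    qed
    have PE: "P j * E = (if j \<in> G then P j else 0)" if j: "j < n" for j
      using orth_family_sum_times_sum[OF P _ G(1), of "{j}"] j by (simp add: E_def)
    have norm_E: "(norm (app E y))\<^sup>2 = (\<Sum>i\<in>G. (norm (app (P i) y))\<^sup>2)"
    proof -
      have "(norm (app E y))\<^sup>2 = (\<Sum>i<n. (norm (app (P i * E) y))\<^sup>2)"
        by (simp add: orth_family_pythagoras[OF P sum, of "app E y"])
      also have "\<dots> = (\<Sum>i<n. if i \<in> G then (norm (app (P i) y))\<^sup>2 else 0)"
        by (intro sum.cong refl) (simp add: PE)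
      also have "\<dots> = (\<Sum>i\<in>{..<n} \<inter> G. (norm (app (P i) y))\<^sup>2)"
        by (simp add: sum.inter_restrict)
      finally show ?thesis using G(1) by (simp add: Int_absorb1)
    qed
    have splitG: "(\<Sum>i<n. f i) = (\<Sum>i\<in>G. f i) + (\<Sum>i\<in>{..<n} - G. f i)" for f :: "nat \<Rightarrow> real"
      using G by (simp add: sum.subset_diff add.commute)
    have "(\<Sum>j\<in>G. (norm (app (P j) (app S y)))\<^sup>2) = (\<Sum>j\<in>G. (norm (app (P j) (app S (app E y))))\<^sup>2)"
      using PSE by (intro sum.cong refl) (metis app_times)
    also have "\<dots> \<le> (\<Sum>j<n. (norm (app (P j) (app S (app E y))))\<^sup>2)"
      using G by (intro sum_mono2) auto
    also have "\<dots> = (norm (app S (app E y)))\<^sup>2"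
      by (rule orth_family_pythagoras[OF P sum, symmetric])
    also have "\<dots> \<le> c\<^sup>2 * (norm (app E y))\<^sup>2 + inner (app F (app E y)) (app E y)"
      by (rule F(3))
    also have "inner (app F (app E y)) (app E y) \<le> \<kappa> * inner (app H y) y"
    proof -
      have conj: "inner (app (P j * F * P j) y) y = inner (app F (app (P j) y)) (app (P j) y)"
        if "j \<in> G" for j
        using that G inner_proj[OF orth_family_proj[OF P]] by auto
      have "inner (app H y) y = (\<Sum>j\<in>G. r * inner (app (P j * F * P j) y) y)"
        by (simp add: H_def sum_app inner_sum_left del: app_times)
      also have "\<dots> = r * (\<Sum>j\<in>G. inner (app F (app (P j) y)) (app (P j) y))"
        unfolding sum_distrib_left by (intro sum.cong refl) (simp only: conj)
      finally have "inner (app H y) y = r * (\<Sum>j\<in>G. inner (app F (app (P j) y)) (app (P j) y))" .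
      moreover have "\<kappa> * r = real (card G)" using \<kappa> by (simp add: r_def)
      ultimately have "\<kappa> * inner (app H y) y
          = real (card G) * (\<Sum>j\<in>G. inner (app F (app (P j) y)) (app (P j) y))"
        by (simp flip: mult.assoc)
      then show ?thesis
        using pos_pinching_le[OF F(1) G(2), of "\<lambda>j. app (P j) y"] by (simp add: E_def sum_app)
    qed
    finally have good: "(\<Sum>j\<in>G. (norm (app (P j) (app S y)))\<^sup>2)
        \<le> c\<^sup>2 * (\<Sum>j\<in>G. (norm (app (P j) y))\<^sup>2) + \<kappa> * inner (app H y) y"
      by (simp add: norm_E)
    have bad: "(norm (app (P j) (app S y)))\<^sup>2 \<le> c\<^sup>2 * (norm (app (P j) y))\<^sup>2" if "j \<in> {..<n} - G" for j
    proof -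
      have "app (P j) (app S y) = \<mu> j *\<^sub>C app (P j) y"
        using PS[of j] that by (metis Diff_iff app_scal app_times lessThan_iff)
      then have eq: "(norm (app (P j) (app S y)))\<^sup>2 = (cmod (\<mu> j))\<^sup>2 * (norm (app (P j) y))\<^sup>2"
        by (simp add: norm_scaleC power_mult_distrib)
      have "app (P j) y = 0 \<or> (cmod (\<mu> j))\<^sup>2 \<le> c\<^sup>2"
        using small[of j] that by (auto intro: power_mono)
      then show ?thesis
        unfolding eq by (auto intro: mult_right_mono)
    qed
    have "(norm (app S y))\<^sup>2 = (\<Sum>j<n. (norm (app (P j) (app S y)))\<^sup>2)"
      by (rule orth_family_pythagoras[OF P sum])
    also have "\<dots> \<le> c\<^sup>2 * (\<Sum>j\<in>G. (norm (app (P j) y))\<^sup>2) + \<kappa> * inner (app H y) y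
        + (\<Sum>j\<in>{..<n} - G. c\<^sup>2 * (norm (app (P j) y))\<^sup>2)"
      unfolding splitG by (intro add_mono good sum_mono bad)
    also have "\<dots> = c\<^sup>2 * (norm y)\<^sup>2 + \<kappa> * inner (app H y) y"
      unfolding orth_family_pythagoras[OF P sum, of y] splitG
      by (simp add: sum_distrib_left distrib_left)
    finally show ?thesis .
  qed
  have normD: "(norm (app D (app V x)))\<^sup>2 \<le> (c\<^sup>2 - \<kappa>) * (norm (app V x))\<^sup>2" for x
  proof -
    have "(norm (app (P j) (app D (app V x))))\<^sup>2 \<le> (c\<^sup>2 - \<kappa>) * (norm (app (P j) (app V x)))\<^sup>2"
      if "j < n" for j
    proof -
      have eq: "app (P j) (app D (app V x)) = \<mu> j *\<^sub>C app (P j) (app V x)"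
        using PD[OF that] by (metis app_scal app_times)
      show ?thesis
      proof (cases "j \<in> G")
        case True
        then show ?thesis
          unfolding eq norm_scaleC power_mult_distrib using \<kappa>_le by (intro mult_right_mono) auto
      next
        case False
        then have "app (P j) (app V x) = 0"
          using VP[OF that] VP0[OF that] by (metis app_times app_zero)
        then show ?thesis unfolding eq by simp
      qed
    qed
    then show ?thesis
      unfolding orth_family_pythagoras[OF P sum, of "app D (app V x)"]
        orth_family_pythagoras[OF P sum, of "app V x"] sum_distrib_left
      by (intro sum_mono) auto
  qed
  show thesis
  proof (rule that[of S'])
    have "J * (S - D) * J \<approx>\<^sub>K 1 * (S - D) * 1"
      by (intro calkin_times J_one calkin_refl)
    then show "S' \<approx>\<^sub>K S"
      unfolding S'_def using calkin_plus[OF calkin_refl[of D]] by fastforce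
    show "norm S' \<le> c"
    proof (rule norm_op_le[OF c])
      fix x
      have "(norm (app S' x))\<^sup>2 = (norm (app J (app S (app J x)) + app V (app D (app V x))))\<^sup>2"
        by (simp add: S'_alt)
      also have "\<dots> \<le> (norm (app S (app J x)))\<^sup>2 + (norm (app D (app V x)))\<^sup>2"
        by (rule norm_contractive_combination[OF adjJ adjV]) (simp add: V(2))
      also have "\<dots> \<le> (c\<^sup>2 * (norm (app J x))\<^sup>2 + \<kappa> * inner (app H (app J x)) (app J x))
          + (c\<^sup>2 - \<kappa>) * (norm (app V x))\<^sup>2"
        by (intro add_mono normS normD)
      \<comment> \<open>By \<open>HJ_le\<close> the excess of \<open>S\<close> costs at most
        \<open>\<kappa> * (norm (app V x))\<^sup>2\<close>, exactly the slack that
        \<open>normD\<close> provides.\<close>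
      also have "\<dots> \<le> (c\<^sup>2 * (norm (app J x))\<^sup>2 + \<kappa> * (norm (app V x))\<^sup>2)
          + (c\<^sup>2 - \<kappa>) * (norm (app V x))\<^sup>2"
        using \<kappa> HJ_le[of x] by (intro add_mono mult_left_mono order_refl) (auto simp: norm_V)
      also have "\<dots> = (c * norm x)\<^sup>2"
        by (simp add: norm_V power_mult_distrib algebra_simps)
      finally show "norm (app S' x) \<le> c * norm x"
        by (rule power2_le_imp_le) (use c in simp)
    qed
    \<comment> \<open>\<open>J\<close> commutes with every \<open>P i\<close>, so entries of
      \<open>S - D\<close> are merely multiplied by \<open>J\<close> on both sides, and zero entries
      stay zero.\<close>
    have block: "P i * S' * P j = P i * D * P j + J * (P i * S * P j - P i * D * P j) * J"
      if "i < n" "j < n" for i j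
    proof -
      have "P i * (J * (S - D) * J) * P j = (P i * J) * (S - D) * (J * P j)"
        by (simp add: mult.assoc)
      also have "\<dots> = (J * P i) * (S - D) * (P j * J)"
        by (simp only: JP[OF that(1)] JP[OF that(2)])
      also have "\<dots> = J * (P i * (S - D) * P j) * J"
        by (simp add: mult.assoc)
      finally have "P i * (J * (S - D) * J) * P j = J * (P i * (S - D) * P j) * J" .
      then show ?thesis by (simp add: S'_def algebra_simps)
    qed
    have PDP: "P i * D * P j = (if i = j then scal (\<mu> j) * P j else 0)" if "i < n" "j < n" for i j
      using orth_family_times[OF P that] PD[OF that(1)] by (auto simp: mult.assoc)
    show "P i * S' * P j = 0" if "i < n" "j < i" for i j
      using that block[of i j] PDP[of i j] low[of i j] by simp
    show "P j * S' * P j = scal (\<mu> j) * P j" if "j < n" for j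
      using that block[of j j] PDP[of j j] diag[of j] by simp
  qed
qed

text \<open>Replacing compact entries by \<open>0\<close> and diagonal entries by their scalars
  changes the sum of all entries by a compact operator, and makes the relations exact.\<close>

lemma calkin_triangular_lift:
  fixes X :: "'a::chilbert_space op"
  assumes P: "orth_family P n" and sum: "(\<Sum>i<n. P i) = 1"
    and X: "ess_le X c"
    and small: "\<And>j. j < n \<Longrightarrow> P j = 0 \<or> cmod (\<mu> j) \<le> c"
    and low: "\<And>i j. i < n \<Longrightarrow> j < i \<Longrightarrow> cpt (P i * X * P j)"
    and diag: "\<And>j. j < n \<Longrightarrow> cpt (P j * (X - scal (\<mu> j)) * P j)"
  obtains S where "S \<approx>\<^sub>K X"
    "\<And>i j. i < n \<Longrightarrow> j < i \<Longrightarrow> P i * S * P j = 0"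
    "\<And>j. j < n \<Longrightarrow> P j * S * P j = scal (\<mu> j) * P j"
    "\<And>i j. i < n \<Longrightarrow> j < n \<Longrightarrow> i \<noteq> j \<Longrightarrow> c \<le> cmod (\<mu> i) \<or> c \<le> cmod (\<mu> j) \<Longrightarrow>
        P i * S * P j = 0"
proof -
  define t where "t i j = (if i = j then scal (\<mu> j) * P j
    else if i < j \<and> cmod (\<mu> i) < c \<and> cmod (\<mu> j) < c then P i * X * P j else 0)" for i j
  define S where "S = (\<Sum>i<n. \<Sum>j<n. t i j)"
  have PtP: "P i * t i j * P j = t i j" if "i < n" "j < n" for i j
  proof (cases "i = j")
    case True
    have "P j * (scal (\<mu> j) * P j) * P j = scal (\<mu> j) * P j * P j * P j"
      by (simp only: mult.assoc[symmetric] scal_commute)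
    then show ?thesis
      using True orth_family_times[OF P that(2) that(2)] by (simp add: t_def mult.assoc)
  next
    case False
    have "P i * (P i * X * P j) * P j = (P i * P i) * X * (P j * P j)"
      by (simp only: mult.assoc)
    then have "P i * (P i * X * P j) * P j = P i * X * P j"
      using orth_family_times[OF P that(1,1)] orth_family_times[OF P that(2,2)] by simp
    then show ?thesis
      using False by (simp add: t_def)
  qed
  have PSP: "P i * S * P j = t i j" if "i < n" "j < n" for i j
  proof -
    have "P i * t k l * P j = (if k = i \<and> l = j then t i j else 0)" if kl: "k < n" "l < n" for k l
    proof -
      have "P i * t k l * P j = (P i * P k) * t k l * (P l * P j)"
        by (subst PtP[OF kl, symmetric]) (simp only: mult.assoc)
      then show ?thesis
        using orth_family_times[OF P \<open>i < n\<close> kl(1)] orth_family_times[OF P kl(2) \<open>j < n\<close>]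
          PtP[OF \<open>i < n\<close> \<open>j < n\<close>] by auto
    qed
    then have "P i * S * P j = (\<Sum>k<n. \<Sum>l<n. if k = i \<and> l = j then t i j else 0)"
      unfolding S_def sum_distrib_left sum_distrib_right by (intro sum.cong refl) auto
    also have "\<dots> = (\<Sum>k<n. if k = i then t i j else 0)"
      using that by (intro sum.cong refl) auto
    finally show ?thesis using that by simp
  qed
  have X_sum: "X = (\<Sum>i<n. \<Sum>j<n. P i * X * P j)"
  proof -
    have "X = (\<Sum>i<n. P i) * X * (\<Sum>j<n. P j)" by (simp add: sum)
    then show ?thesis by (simp only: sum_distrib_left sum_distrib_right) (subst sum.swap)
  qed
  have "t i j \<approx>\<^sub>K P i * X * P j" if ij: "i < n" "j < n" for i j
  proof -
    note Pi = orth_family_proj[OF P ij(1)] and Pj = orth_family_proj[OF P ij(2)]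
    have PP: "P i * P j = (if i = j then P i else 0)" by (rule orth_family_times[OF P ij])
    \<comment> \<open>The last two cases are a row and a column with a root of modulus
      \<open>c\<close>, whose off-diagonal entries are compact.\<close>
    consider "i = j" | "j < i" | "i < j" "cmod (\<mu> i) < c" "cmod (\<mu> j) < c"
      | "i < j" "P i = 0 \<or> P j = 0" | "i < j" "cmod (\<mu> i) = c" | "i < j" "cmod (\<mu> j) = c"
      using small[OF ij(1)] small[OF ij(2)] by linarith
    then show ?thesis
    proof cases
      case 1
      have "P j * scal (\<mu> j) * P j = scal (\<mu> j) * P j * P j"
        by (simp only: scal_commute)
      then have "P j * (X - scal (\<mu> j)) * P j = P i * X * P j - t i j"
        using 1 by (simp add: t_def algebra_simps proj_idem[OF Pj])
      then show ?thesis
        using diag[OF ij(2)] by (simp add: calkin_eq_def cpt_minus_commute)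
    next
      case 2
      then show ?thesis
        using low[OF ij(1) 2] cpt_uminus by (auto simp: t_def calkin_eq_def)
    next
      case 3
      then show ?thesis by (simp add: t_def)
    next
      case 4
      then show ?thesis by (auto simp: t_def)
    next
      case 5
      have "cpt (P i * X * (1 - P i) * P j)"
        using cpt_extremal_eigenvalue_block'[OF X Pi diag[OF ij(1)] 5(2)] by (rule cpt_mult_right)
      moreover have "P i * X * (1 - P i) * P j = P i * X * P j"
        using 5 PP by (simp add: algebra_simps mult.assoc)
      ultimately show ?thesis
        using 5 cpt_uminus by (auto simp: t_def calkin_eq_def)
    next
      case 6
      have "cpt (P i * ((1 - P j) * X * P j))"
        using cpt_extremal_eigenvalue_block[OF X Pj diag[OF ij(2)] 6(2)] by (rule cpt_mult_left)
      moreover have "P i * ((1 - P j) * X * P j) = (P i - P i * P j) * X * P j"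
        by (simp add: algebra_simps mult.assoc)
      ultimately show ?thesis
        using 6 PP cpt_uminus by (auto simp: t_def calkin_eq_def)
    qed
  qed
  then have "S \<approx>\<^sub>K X"
    by (subst X_sum, unfold S_def) (intro calkin_sum, auto)
  then show thesis
    by (rule that) (auto simp: PSP t_def)
qed

lemma annihilating_perturbation:
  fixes X :: "'a::chilbert_space op"
  assumes inf: "\<not> cpt (1 :: 'a op)" and X: "ess_le X c" and c: "0 \<le> c"
    and prod: "cpt (factor_prod X \<mu> n)"
  obtains S where "S \<approx>\<^sub>K X" "norm S \<le> c" "factor_prod S \<mu> n = 0"
proof -
  \<comment> \<open>For \<open>n = 0\<close> the product is \<open>1\<close>, which is not
    compact.\<close>
  obtain m where n: "n = Suc m" using inf prod by (cases n) auto
  have "proj (1 :: 'a op)" by (simp add: proj_def)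
  moreover have "cpt ((1 - 1) * X * 1)" by (simp add: cpt_zero)
  moreover have "cpt (factor_prod X \<mu> (Suc m) * 1)" using prod by (simp add: n)
  ultimately obtain P0 where P0: "orth_family P0 n" "(\<Sum>i<n. P0 i) = 1"
    and low0: "\<And>i j. i < n \<Longrightarrow> j < i \<Longrightarrow> cpt (P0 i * X * P0 j)"
    and diag0: "\<And>j. j < n \<Longrightarrow> cpt (P0 j * (X - scal (\<mu> j)) * P0 j)"
    using triangular_decomposition[of 1 X \<mu> m] unfolding n by blast
  define B where "B = {j. j < n \<and> c < cmod (\<mu> j)}"
  have B: "B \<subseteq> {..<n}" by (auto simp: B_def)
  have cptB: "cpt (P0 i)" if "i \<in> B" for i
    using that cpt_large_eigenvalue_block[OF X c orth_family_proj[OF P0(1)] diag0]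
    by (auto simp: B_def)
  \<comment> \<open>Some block must remain to receive the compact ones; otherwise the identity would
    be a sum of compact projections.\<close>
  have "\<exists>k<n. k \<notin> B"
  proof (rule ccontr)
    assume "\<not> (\<exists>k<n. k \<notin> B)"
    then have "cpt (\<Sum>i<n. P0 i)" using cptB by (intro cpt_sum) auto
    then show False using inf P0(2) by simp
  qed
  then obtain k where k: "k < n" "k \<notin> B" by blast
  obtain P where P: "orth_family P n" "(\<Sum>i<n. P i) = 1" "\<And>i. i \<in> B \<Longrightarrow> P i = 0"
    and PP0: "\<And>i. i < n \<Longrightarrow> P i \<approx>\<^sub>K P0 i"
    using orth_family_absorb_compact[OF P0 B cptB k] by metis
  have small: "P j = 0 \<or> cmod (\<mu> j) \<le> c" if "j < n" for j
    using P(3)[of j] that by (auto simp: B_def not_less)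
  have low: "cpt (P i * X * P j)" if "i < n" "j < i" for i j
    using low0[OF that] that cpt_cong[OF calkin_times[OF calkin_times[OF PP0 calkin_refl] PP0], of i j X]
    by simp
  have diag: "cpt (P j * (X - scal (\<mu> j)) * P j)" if "j < n" for j
    using diag0[OF that] that
      cpt_cong[OF calkin_times[OF calkin_times[OF PP0 calkin_refl] PP0], of j j "X - scal (\<mu> j)"]
    by simp
  obtain S where S: "S \<approx>\<^sub>K X"
    "\<And>i j. i < n \<Longrightarrow> j < i \<Longrightarrow> P i * S * P j = 0"
    "\<And>j. j < n \<Longrightarrow> P j * S * P j = scal (\<mu> j) * P j"
    "\<And>i j. i < n \<Longrightarrow> j < n \<Longrightarrow> i \<noteq> j \<Longrightarrow> c \<le> cmod (\<mu> i) \<or> c \<le> cmod (\<mu> j) \<Longrightarrow>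
        P i * S * P j = 0"
    using calkin_triangular_lift[OF P(1,2) X small low diag] by blast
  have ess_S: "ess_le S c" using ess_le_cong[OF calkin_sym[OF S(1)] X] .
  obtain S' where S': "S' \<approx>\<^sub>K S" "norm S' \<le> c"
    "\<And>i j. i < n \<Longrightarrow> j < i \<Longrightarrow> P i * S' * P j = 0"
    "\<And>j. j < n \<Longrightarrow> P j * S' * P j = scal (\<mu> j) * P j"
    using norm_reduction[OF P(1,2) c small S(2,3,4) ess_S] by blast
  show thesis
    using calkin_trans[OF S'(1) S(1)] S'(2) factor_prod_triangular_eq_0[OF P(1,2) S'(3,4)]
    by (rule that)
qed

section \<open>Polynomials in an operator and the essential norm\<close>

lemma poly_operator_eq_sum:
  assumes "degree p \<le> N"
  shows "poly_operator p T x = (\<Sum>i\<le>N. coeff p i *\<^sub>C (T ^^ i) x)"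
  unfolding poly_operator_def using assms
  by (intro sum.mono_neutral_left) (auto simp: coeff_eq_0)

text \<open>The product is \<open>pCons 0 q - smult a q\<close>, and the coefficient shift in
  \<open>pCons 0 q\<close> amounts to one more application of \<open>X\<close>.\<close>

lemma poly_operator_linear_factor:
  "poly_operator (q * [:- a, 1:]) (app X) x = poly_operator q (app X) (app (X - scal a) x)"
proof -
  have pow_scaleC: "(app X ^^ i) (a *\<^sub>C y) = a *\<^sub>C (app X ^^ i) y" for i y
    by (induction i) (simp_all add: app_scaleC)
  have pow_diff: "(app X ^^ i) (y - z) = (app X ^^ i) y - (app X ^^ i) z" for i y z
    by (induction i) (simp_all add: app_diff)
  let ?N = "degree q"
  have eq: "q * [:- a, 1:] = pCons 0 q - smult a q"
    by simp
  have "degree (q * [:- a, 1:]) \<le> Suc ?N"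
    by (rule order_trans[OF degree_mult_le]) simp
  then have "poly_operator (q * [:- a, 1:]) (app X) x
      = (\<Sum>i\<le>Suc ?N. coeff (pCons 0 q) i *\<^sub>C (app X ^^ i) x)
        - (\<Sum>i\<le>Suc ?N. coeff (smult a q) i *\<^sub>C (app X ^^ i) x)"
    by (simp only: poly_operator_eq_sum eq coeff_diff complex_vector.scale_left_diff_distrib sum_subtractf)
  also have "(\<Sum>i\<le>Suc ?N. coeff (pCons 0 q) i *\<^sub>C (app X ^^ i) x)
      = (\<Sum>i\<le>?N. coeff q i *\<^sub>C (app X ^^ i) (app X x))"
    by (subst sum.atMost_Suc_shift) (simp add: funpow_swap1)
  also have "(\<Sum>i\<le>Suc ?N. coeff (smult a q) i *\<^sub>C (app X ^^ i) x)
      = (\<Sum>i\<le>?N. coeff q i *\<^sub>C (app X ^^ i) (a *\<^sub>C x))"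
    by (simp add: coeff_eq_0 pow_scaleC scaleC_scaleC mult.commute)
  finally show ?thesis
    by (simp add: poly_operator_def pow_diff complex_vector.scale_right_diff_distrib sum_subtractf)
qed

lemma app_factor_prod:
  "app (factor_prod X \<mu> n) = poly_operator (\<Prod>j<n. [:- \<mu> j, 1:]) (app X)"
proof (induction n)
  case 0
  show ?case by (rule ext) (simp add: poly_operator_def)
next
  case (Suc n)
  show ?case
    by (rule ext) (simp add: poly_operator_linear_factor Suc[symmetric] del: mult_pCons_right)
qed

lemma prod_powers_eq_prod_linear:
  fixes l :: "nat \<Rightarrow> 'b::comm_ring_1"
  shows "\<exists>(m::nat) \<mu>. (\<Prod>i=1..n. [:- l i, 1:] ^ k i) = (\<Prod>j<m. [:- \<mu> j, 1:])"
proof (induction n)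
  case 0
  show ?case by (rule exI[of _ 0]) simp
next
  case (Suc n)
  then obtain m :: nat and \<mu> where IH: "(\<Prod>i=1..n. [:- l i, 1:] ^ k i) = (\<Prod>j<m. [:- \<mu> j, 1:])"
    by blast
  have "(\<Prod>j<m + r. [:- (if j < m then \<mu> j else a), 1:]) = (\<Prod>j<m. [:- \<mu> j, 1:]) * [:- a, 1:] ^ r"
    for r a
    by (induction r) (simp_all add: mult_ac del: mult_pCons_left mult_pCons_right)
  from this[where r = "k (Suc n)" and a = "l (Suc n)"] have "(\<Prod>i=1..Suc n. [:- l i, 1:] ^ k i)
      = (\<Prod>j<m + k (Suc n). [:- (if j < m then \<mu> j else l (Suc n)), 1:])"
    by (simp only: prod.cl_ivl_Suc IH) simp
  then show ?case
    by (intro exI[of _ "m + k (Suc n)"] exI[of _ "\<lambda>j. if j < m then \<mu> j else l (Suc n)"])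
qed

lemma compact_operatorE:
  assumes "compact_operator K"
  obtains L where "cpt L" "app L = K"
  using assms that[of "Op K"] by (simp add: cpt_def Op_inverse compact_operator_def)

lemma essential_norm_app:
  fixes X :: "'a::chilbert_space op"
  shows "0 \<le> essential_norm (app X)" and "ess_le X (essential_norm (app X))"
    and "S \<approx>\<^sub>K X \<Longrightarrow> essential_norm (app X) \<le> norm S"
proof -
  have coset: "onorm ` calkin_coset (app X) = (\<lambda>K. norm (X + K)) ` {K. cpt K}"
  proof (intro equalityI subsetI)
    fix r assume "r \<in> onorm ` calkin_coset (app X)"
    then obtain K where K: "compact_operator K" "r = onorm (\<lambda>x. app X x + K x)"
      by (auto simp: calkin_coset_def)
    from K(1) obtain L where L: "cpt L" "app L = K" by (rule compact_operatorE)
    then show "r \<in> (\<lambda>K. norm (X + K)) ` {K. cpt K}"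
      using K(2) by (auto simp: norm_op_def plus_op.rep_eq)
  next
    fix r assume "r \<in> (\<lambda>K. norm (X + K)) ` {K. cpt K}"
    then show "r \<in> onorm ` calkin_coset (app X)"
      by (auto simp: calkin_coset_def norm_op_def plus_op.rep_eq cpt_def)
  qed
  have ess: "essential_norm (app X) = (INF K\<in>{K. cpt K}. norm (X + K))"
    unfolding essential_norm_def coset ..
  have ne: "{K :: 'a op. cpt K} \<noteq> {}" using cpt_zero by blast
  have bdd: "bdd_below ((\<lambda>K. norm (X + K)) ` {K. cpt K})" by (rule bdd_belowI2[of _ 0]) simp
  show "0 \<le> essential_norm (app X)"
    unfolding ess using ne by (rule cINF_greatest) simp
  show "ess_le X (essential_norm (app X))"
    unfolding ess_le_def
  proof (intro allI impI)
    fix e :: real assume "0 < e"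
    then have "(INF K\<in>{K. cpt K}. norm (X + K)) < essential_norm (app X) + e"
      by (simp add: ess)
    then show "\<exists>K. cpt K \<and> norm (X + K) \<le> essential_norm (app X) + e"
      unfolding cINF_less_iff[OF ne bdd] by (auto intro: less_imp_le)
  qed
  show "essential_norm (app X) \<le> norm S" if "S \<approx>\<^sub>K X"
    using cINF_lower[OF bdd, of "S - X"] that by (simp add: ess calkin_eq_def)
qed

theorem theorem11:
  fixes T :: "'a::chilbert_space \<Rightarrow> 'a"
    and n :: nat and l :: "nat \<Rightarrow> complex" and k :: "nat \<Rightarrow> nat" and p :: "complex poly"
  assumes "infinite_dimensional TYPE('a)"
    and "bounded_clinear T"
    and "n \<ge> 1"
    and "inj_on l {1..n}"
    and "\<And>i. i \<in> {1..n} \<Longrightarrow> k i \<ge> 2"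
    and "p = (\<Prod>i=1..n. [:- l i, 1:] ^ k i)"
    and "compact_operator (poly_operator p T)"
  shows "\<exists>K. compact_operator K \<and>
           poly_operator p (\<lambda>x. T x + K x) = (\<lambda>x. 0) \<and>
           onorm (\<lambda>x. T x + K x) = essential_norm T"
proof -
  obtain X where T: "T = app X"
    using assms(2) by (metis Op_inverse mem_Collect_eq)
  obtain m :: nat and \<mu> where p: "p = (\<Prod>j<m. [:- \<mu> j, 1:])"
    using prod_powers_eq_prod_linear[of l k n] assms(6) by metis
  have "cpt (factor_prod X \<mu> m)"
    using assms(7) by (simp add: cpt_def app_factor_prod p T)
  then obtain S where S: "S \<approx>\<^sub>K X" "norm S \<le> essential_norm T" "factor_prod S \<mu> m = 0"
    using annihilating_perturbation[OF not_cpt_one[OF assms(1)]] essential_norm_app(1,2)[of X]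
    unfolding T by metis
  have app_S: "(\<lambda>x. T x + app (S - X) x) = app S" by (simp add: T)
  show ?thesis
  proof (intro exI[of _ "app (S - X)"] conjI)
    show "compact_operator (app (S - X))"
      using S(1) by (simp add: calkin_eq_def cpt_def)
    show "poly_operator p (\<lambda>x. T x + app (S - X) x) = (\<lambda>x. 0)"
      unfolding app_S p app_factor_prod[symmetric] S(3) by (rule ext) simp
    \<comment> \<open>The lower bound holds because \<open>S\<close> belongs to the coset over which
      the essential norm is the infimum.\<close>
    show "onorm (\<lambda>x. T x + app (S - X) x) = essential_norm T"
      unfolding app_S norm_op_def[symmetric]
      using S(2) essential_norm_app(3)[OF S(1)] by (simp add: T)
  qed
qed

end
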